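(* There exists a Euclidean tight $6$-design $(X,w)$ of $\mathbb{R}^{22}$ supported by two concentric spheres centered at the origin with radii $r_1<r_2$, such that $|X|=\binom{22+3}{3}=2300$, $r_2/r_1=\sqrt{11}$, and the weight function is constant on each layer, $w\equiv w_1$ on $X_1=X\cap S_1$ and $w\equiv w_2$ on $X_2=X\cap S_2$, with $w_2/w_1=1/729$. Moreover $|X_1|=275$ and $|X_2|=2025$.
   Context: A weighted finite set in $\mathbb{R}^n$ is a pair $(X,w)$ with $X\subset\mathbb{R}^n$ finite and $w:X\to\mathbb{R}_{>0}$. Suppose $X$ is contained in the union of $p$ concentric spheres $S_1,\dots,S_p$ centered at the origin with distinct radii $r_1,\dots,r_p$, each meeting $X$, and put $X_i=X\cap S_i$ and $w(X_i)=\sum_{x\in X_i}w(x)$. Let $\sigma_i$ be the surface measure on $S_i$ and $|S_i|=\int_{S_i}d\sigma_i$. For a positive integer $t$, $(X,w)$ is a Euclidean $t$-design if $\sum_{i=1}^p \frac{w(X_i)}{|S_i|}\int_{S_i} f(x)\,d\sigma_i(x)=\sum_{x\in X} w(x)f(x)$ for every real polynomial $f$ in $n$ variables of total degree at most $t$. If $(X,w)$ is a Euclidean $2e$-design, then $|X|\ge \dim \mathcal{P}_e(S)$, where $\mathcal{P}_e(S)$ is the space of restrictions to $S=S_1\cup\dots\cup S_p$ of polynomials of degree at most $e$. A Euclidean $2e$-design is a Euclidean tight $2e$-design of $\mathbb{R}^n$ if $|X|=\binom{n+e}{e}$, i.e. equality holds and $\dim\mathcal{P}_e(S)=\binom{n+e}{e}$.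 *)

theory Defs
  imports "HOL-Analysis.Analysis" "HOL-Library.Function_Algebras"
begin

definition multi_indices :: "nat \<Rightarrow> ('n::finite \<Rightarrow> nat) set" where
  "multi_indices t = {a. (\<Sum>i\<in>UNIV. a i) \<le> t}"

definition monomial_fun :: "('n::finite \<Rightarrow> nat) \<Rightarrow> real^'n \<Rightarrow> real" where
  "monomial_fun a = (\<lambda>x. \<Prod>i\<in>UNIV. (x $ i) ^ (a i))"

definition poly_funs :: "nat \<Rightarrow> (real^'n::finite \<Rightarrow> real) set" where
  "poly_funs t = {f. \<exists>c. f = (\<lambda>x. \<Sum>a\<in>multi_indices t. c a * monomial_fun a x)}"

text \<open>Normalized surface integral over the sphere of radius r centred at 0:
  (1/|S_r|) \<integral>_{S_r} f d\<sigma>_r.  The normalized surface measure on S_r is realised as the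
  image of the normalized Lebesgue measure on the unit ball under the radial projection
  x \<mapsto> r x/|x| (cone measure, which coincides with normalized surface measure on spheres).
  For r = 0 this gives f 0.\<close>
definition sphere_avg :: "real \<Rightarrow> (real^'n::finite \<Rightarrow> real) \<Rightarrow> real" where
  "sphere_avg r f =
     (LINT x : ball 0 1 | lborel. f (r *\<^sub>R (x /\<^sub>R norm x))) / measure lborel (ball (0::real^'n) 1)"

definition layer :: "(real^'n::finite) set \<Rightarrow> real \<Rightarrow> (real^'n) set" where
  "layer X r = {x\<in>X. norm x = r}"

definition euclidean_design :: "(real^'n::finite) set \<Rightarrow> (real^'n \<Rightarrow> real) \<Rightarrow> nat \<Rightarrow> bool" where
  "euclidean_design X w t \<longleftrightarrow>
     finite X \<and> (\<forall>x\<in>X. w x > 0) \<and> t > 0 \<and>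
     (\<forall>f\<in>poly_funs t.
        (\<Sum>r\<in>norm ` X. (\<Sum>x\<in>layer X r. w x) * sphere_avg r f) = (\<Sum>x\<in>X. w x * f x))"

text \<open>S = union of the spheres, P_e(S) = restrictions to S of polynomials of degree \<le> e
  (restriction represented by extending by 0 outside S).\<close>
definition support_spheres :: "(real^'n::finite) set \<Rightarrow> (real^'n) set" where
  "support_spheres X = {y. norm y \<in> norm ` X}"

definition dim_PeS :: "nat \<Rightarrow> (real^'n::finite) set \<Rightarrow> nat" where
  "dim_PeS e S = vector_space.dim (\<lambda>(c::real) f x. c * f x)
      ((\<lambda>f x. if x \<in> S then f x else 0) ` poly_funs e)"

definition euclidean_tight_design :: "(real^'n::finite) set \<Rightarrow> (real^'n \<Rightarrow> real) \<Rightarrow> nat \<Rightarrow> bool" where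
  "euclidean_tight_design X w e \<longleftrightarrow>
     euclidean_design X w (2 * e) \<and>
     card X = (CARD('n) + e) choose e \<and>
     dim_PeS e (support_spheres X :: (real^'n) set) = (CARD('n) + e) choose e"

end

theory Submission
  imports Defs "HOL-Library.Code_Binary_Nat"
begin

text \<open>
  Project the minimal vectors of the Leech lattice at 60 degrees to a fixed one orthogonally to it.
  They span 2300 lines, with coordinates \<open>(d, z)\<close> and squared norm \<open>d\<^sup>2 / 2 + |z|\<^sup>2\<close>, which form a
  spherical 7-design of \<open>\<real>\<^sup>2\<^sup>3\<close>: \<open>\<Sum>\<langle>y, u\<rangle>\<^sup>6\<close> is a multiple of \<open>|u|\<^sup>6\<close>.
  There is a direction in which these lines have only two heights \<open>s\<close>, in ratio \<open>3 : 1\<close>; projecting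
  centrally to the hyperplane of height 1, with weight \<open>s\<^sup>6\<close>, gives 275 and 2025 points on two spheres
  of \<open>\<real>\<^sup>2\<^sup>2\<close>. Reading the sextic identity at \<open>u = (\<xi>, t)\<close> as a polynomial in \<open>t\<close> shows that every
  weighted power sum \<open>\<Sum>w(x) \<langle>x, \<xi>\<rangle>\<^sup>k\<close> with \<open>k \<le> 6\<close> is a multiple of \<open>|\<xi>|\<^sup>k\<close>, and by polarization and
  rotation invariance this is the design property.

  The sextic identity itself is a computation with characters of sign vectors: up to degree 6 the
  only characters that do not average to 0 over the code words are the trivial one and those of the
  77 hexads of the Steiner system \<open>S(3, 6, 22)\<close>, and the latter are cancelled by the lines supported
  on hexads.

  Finally a cubic that vanishes on two spheres around the origin vanishes at four points of every line
  through the origin, so it is zero and the restriction of cubics loses no dimension.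
\<close>

section \<open>Spherical averages and power sums\<close>

text \<open>Boxes determine Lebesgue measure, and the preimage of a box under \<open>g\<close> is
  its image under the orthogonal map \<open>inv g\<close>, which has the same measure.\<close>

lemma distr_lborel_orthogonal_transformation:
  fixes g :: "real^'n::{finite,wellorder} \<Rightarrow> real^'n::_"
  assumes g: "orthogonal_transformation g"
  shows "distr lborel borel g = lborel"
proof (rule lborel_eqI[symmetric])
  have lin: "linear g"
    using g by (rule orthogonal_transformation_linear)
  have meas [measurable]: "g \<in> borel_measurable borel"
    using lin by (intro borel_measurable_continuous_onI linear_continuous_on linear_conv_bounded_linear[THEN iffD1])
  fix l u :: "real^'n::_"
  assume le: "\<And>b. b \<in> Basis \<Longrightarrow> l \<bullet> b \<le> u \<bullet> b"
  have inv_g: "orthogonal_transformation (inv g)"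
    using g by (rule orthogonal_transformation_inv)
  have vim: "g -` box l u = inv g ` box l u"
    using bij_vimage_eq_inv_image[OF orthogonal_transformation_bij[OF g]] .
  have "box l u \<in> lmeasurable"
    by simp
  note im = measurable_orthogonal_image[OF inv_g this] measure_orthogonal_image[OF inv_g this]
  have "emeasure (distr lborel borel g) (box l u) = emeasure lborel (g -` box l u)"
    by (subst emeasure_distr) auto
  also have "\<dots> = emeasure lebesgue (inv g ` box l u)"
    using measurable_sets[OF meas, of "box l u"] unfolding vim[symmetric]
    by (simp add: emeasure_lborel_countable)
  also have "\<dots> = emeasure lborel (box l u)"
    using im by (simp add: emeasure_eq_measure2 fmeasurableD2)
  finally show "emeasure (distr lborel borel g) (box l u) = (\<Prod>b\<in>Basis. (u - l) \<bullet> b)"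
    using le by simp
qed simp

section \<open>Averages of continuous functions over spheres\<close>

lemma borel_measurable_radial:
  fixes f :: "real^'n \<Rightarrow> real"
  assumes "continuous_on UNIV f"
  shows "(\<lambda>x. f (r *\<^sub>R (x /\<^sub>R norm x))) \<in> borel_measurable lborel"
proof -
  have [measurable]: "f \<in> borel_measurable borel"
    using assms by (rule borel_measurable_continuous_onI)
  show ?thesis
    by measurable
qed

lemma integrable_radial:
  fixes f :: "real^'n \<Rightarrow> real"
  assumes f: "continuous_on UNIV f"
  shows "set_integrable lborel (ball 0 1) (\<lambda>x. f (r *\<^sub>R (x /\<^sub>R norm x)))"
proof -
  have "bounded (f ` cball 0 \<bar>r\<bar>)"
    by (intro compact_imp_bounded compact_continuous_image continuous_on_subset[OF f]) auto
  then obtain B where B: "\<And>y. norm y \<le> \<bar>r\<bar> \<Longrightarrow> \<bar>f y\<bar> \<le> B"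
    unfolding bounded_iff by (metis imageI mem_cball_0 real_norm_def)
  \<comment> \<open>The argument has norm \<open>\<bar>r\<bar>\<close>, except at the centre, where
    division by zero makes it 0.\<close>
  have "\<bar>f (r *\<^sub>R (x /\<^sub>R norm x))\<bar> \<le> B" for x
    by (rule B) (cases "x = 0", auto simp: abs_mult field_simps)
  then show ?thesis
    unfolding set_integrable_def
    using borel_measurable_radial[OF f] emeasure_bounded_finite[of "ball (0::real^'n) 1"]
    by (intro integrableI_bounded_set_indicator[where B = B]) auto
qed

lemma measure_unit_ball_pos: "measure lborel (ball (0::real^'n) 1) > 0"
  using content_ball_pos[of 1 "0::real^'n"] by simp

text \<open>Stated for an abstract functional, so that it serves \<open>sphere_avg r\<close> as well
  as the defect of the design identity. Additivity is asked for continuous functions only, since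
  integrals add when they exist; homogeneity holds for all functions.\<close>

lemma linear_on_continuous_sum:
  fixes L :: "(real^'n \<Rightarrow> real) \<Rightarrow> real"
  assumes L: "\<And>f g. continuous_on UNIV f \<Longrightarrow> continuous_on UNIV g \<Longrightarrow> L (\<lambda>x. f x + g x) = L f + L g"
      "\<And>c f. L (\<lambda>x. c * f x) = c * L f"
    and "finite A" "\<And>i. i \<in> A \<Longrightarrow> continuous_on UNIV (f i)"
  shows "L (\<lambda>x. \<Sum>i\<in>A. c i * f i x) = (\<Sum>i\<in>A. c i * L (f i))"
  using assms(3,4)
proof (induction A rule: finite_induct)
  case empty
  then show ?case
    using L(2)[of 0 "\<lambda>_. 0"] by simp
next
  case (insert i A)
  have "L (\<lambda>x. c i * f i x + (\<Sum>i\<in>A. c i * f i x)) =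
      L (\<lambda>x. c i * f i x) + L (\<lambda>x. \<Sum>i\<in>A. c i * f i x)"
    using insert.prems by (intro L(1) continuous_intros) auto
  then show ?case
    using insert by (simp add: L(2))
qed

lemma sphere_avg_add:
  fixes f g :: "real^'n \<Rightarrow> real"
  assumes "continuous_on UNIV f" "continuous_on UNIV g"
  shows "sphere_avg r (\<lambda>x. f x + g x) = sphere_avg r f + sphere_avg r g"
  unfolding sphere_avg_def add_divide_distrib[symmetric]
  by (subst set_integral_add(2)[OF assms[THEN integrable_radial]]) (rule refl)

lemma sphere_avg_cmult:
  fixes f :: "real^'n \<Rightarrow> real"
  shows "sphere_avg r (\<lambda>x. c * f x) = c * sphere_avg r f"
  unfolding sphere_avg_def by simp

lemma sphere_avg_sum:
  fixes f :: "'a \<Rightarrow> real^'n \<Rightarrow> real"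
  assumes "finite A" "\<And>i. i \<in> A \<Longrightarrow> continuous_on UNIV (f i)"
  shows "sphere_avg r (\<lambda>x. \<Sum>i\<in>A. c i * f i x) = (\<Sum>i\<in>A. c i * sphere_avg r (f i))"
  by (rule linear_on_continuous_sum[of "sphere_avg r"])
    (use assms in \<open>auto intro: sphere_avg_add sphere_avg_cmult\<close>)

lemma sphere_avg_eq_const:
  fixes f :: "real^'n \<Rightarrow> real"
  assumes f: "continuous_on UNIV f" and c: "\<And>x. norm x = \<bar>r\<bar> \<Longrightarrow> f x = c"
  shows "sphere_avg r f = c"
proof -
  have eq: "(LINT x : ball 0 1 | lborel. f (r *\<^sub>R (x /\<^sub>R norm x))) =
      (LINT x : ball (0::real^'n) 1 | lborel. c)"
    unfolding set_lebesgue_integral_def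
  proof (rule integral_cong_AE)
    \<comment> \<open>The origin, which the radial map need not send to the sphere, is a null
      set.\<close>
    show "AE x in lborel. indicator (ball 0 1) x *\<^sub>R f (r *\<^sub>R (x /\<^sub>R norm x)) =
        indicator (ball 0 1) x *\<^sub>R c"
      using AE_lborel_singleton[of "0::real^'n"] by eventually_elim (subst c, auto simp: abs_mult field_simps)
  qed (use borel_measurable_radial[OF f, of r] in
      \<open>auto intro!: borel_measurable_times borel_measurable_indicator\<close>)
  have "emeasure lborel (ball (0::real^'n) 1) < \<infinity>"
    using emeasure_bounded_finite[of "ball (0::real^'n) 1"] by simp
  then show ?thesis
    using measure_unit_ball_pos[where 'n = 'n]
    unfolding sphere_avg_def eq by (simp add: set_integral_const)
qed

lemma sphere_avg_scale: "sphere_avg r f = sphere_avg 1 (\<lambda>x. f (r *\<^sub>R x))"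
  by (simp add: sphere_avg_def)

lemma sphere_avg_orthogonal_transformation:
  fixes f :: "real^'n::{finite,wellorder} \<Rightarrow> real"
  assumes f: "continuous_on UNIV f" and g: "orthogonal_transformation (g :: real^'n::_ \<Rightarrow> real^'n::_)"
  shows "sphere_avg r (\<lambda>x. f (g x)) = sphere_avg r f"
proof -
  have lin: "linear g"
    using g by (rule orthogonal_transformation_linear)
  have cont: "continuous_on UNIV g"
    using lin by (intro linear_continuous_on linear_conv_bounded_linear[THEN iffD1])
  have [measurable]: "g \<in> borel_measurable borel" "f \<in> borel_measurable borel"
    using cont f by (intro borel_measurable_continuous_onI; simp)+
  let ?F = "\<lambda>x. indicator (ball 0 1) x *\<^sub>R f (r *\<^sub>R (x /\<^sub>R norm x))"
  have "(LINT x|lborel. ?F x) = (LINT x|distr lborel borel g. ?F x)"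
    using distr_lborel_orthogonal_transformation[OF g] by simp
  also have "\<dots> = (LINT x|lborel. ?F (g x))"
    using borel_measurable_radial[OF f] by (intro integral_distr borel_measurable_scaleR borel_measurable_indicator) auto
  also have "\<dots> = (LINT x|lborel. indicator (ball 0 1) x *\<^sub>R f (g (r *\<^sub>R (x /\<^sub>R norm x))))"
  proof (rule Bochner_Integration.integral_cong)
    fix x
    have "norm (g x) = norm x"
      using g by (rule orthogonal_transformation_norm)
    then show "?F (g x) = indicator (ball 0 1) x *\<^sub>R f (g (r *\<^sub>R (x /\<^sub>R norm x)))"
      by (simp add: linear_cmul[OF lin] indicator_def)
  qed simp
  finally show ?thesis
    by (simp add: sphere_avg_def set_lebesgue_integral_def)
qed

text \<open>A rotation takes a multiple of a fixed unit vector to \<xi>, and homogeneity pulls out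
  \<open>r\<close> and \<open>norm \<xi>\<close>. One constant serves all radii, so the layers of a
  design can be added up.\<close>

lemma sphere_avg_inner_power:
  obtains A where "\<And>r (\<xi> :: real^'n::{finite,wellorder}).
    sphere_avg r (\<lambda>x. (x \<bullet> \<xi>) ^ k) = A * (r * norm \<xi>) ^ k"
proof
  fix r and \<xi> :: "real^'n::_"
  define u :: "real^'n::_" where "u = axis undefined 1"
  have "norm (norm \<xi> *\<^sub>R u) = norm \<xi>"
    by (simp add: u_def)
  then obtain g :: "real^'n::_ \<Rightarrow> real^'n::_"
    where g: "orthogonal_transformation g" "g (norm \<xi> *\<^sub>R u) = \<xi>"
    by (rule orthogonal_transformation_exists)
  have "sphere_avg r (\<lambda>x. (x \<bullet> \<xi>) ^ k) = sphere_avg r (\<lambda>x. (g x \<bullet> \<xi>) ^ k)"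
    by (rule sphere_avg_orthogonal_transformation[symmetric]) (intro continuous_intros, rule g)
  also have "(\<lambda>x. (g x \<bullet> \<xi>) ^ k) = (\<lambda>x. (norm \<xi> * (x \<bullet> u)) ^ k)"
  proof
    fix x
    have "g x \<bullet> \<xi> = g x \<bullet> g (norm \<xi> *\<^sub>R u)"
      by (simp only: g(2))
    also have "\<dots> = norm \<xi> * (x \<bullet> u)"
      using g(1) by (simp only: orthogonal_transformation_def inner_scaleR_right)
    finally show "(g x \<bullet> \<xi>) ^ k = (norm \<xi> * (x \<bullet> u)) ^ k"
      by simp
  qed
  also have "sphere_avg r \<dots> = sphere_avg 1 (\<lambda>x. (r * norm \<xi>) ^ k * (x \<bullet> u) ^ k)"
    by (subst sphere_avg_scale[of r]) (simp add: power_mult_distrib mult_ac)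
  finally show "sphere_avg r (\<lambda>x. (x \<bullet> \<xi>) ^ k) = sphere_avg 1 (\<lambda>x. (x \<bullet> u) ^ k) * (r * norm \<xi>) ^ k"
    by (simp add: sphere_avg_cmult)
qed

text \<open>Replacing \<xi> by \<open>t *\<^sub>R \<eta> + \<xi>\<close> gives a polynomial in
  \<open>t\<close> that vanishes identically; its coefficient of \<open>t\<close> splits off one
  factor \<open>x \<bullet> \<eta>\<close>. The function \<open>g\<close> collects the factors split
  off so far.\<close>

lemma polarization:
  fixes L :: "(real^'n \<Rightarrow> real) \<Rightarrow> real" and g :: "real^'n \<Rightarrow> real"
  assumes L: "\<And>f g. continuous_on UNIV f \<Longrightarrow> continuous_on UNIV g \<Longrightarrow> L (\<lambda>x. f x + g x) = L f + L g"
      "\<And>c f. L (\<lambda>x. c * f x) = c * L f"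
    and g: "continuous_on UNIV g"
    and zero: "\<And>\<xi>. L (\<lambda>x. g x * (x \<bullet> \<xi>) ^ length \<eta>s) = 0"
  shows "L (\<lambda>x. g x * (\<Prod>\<eta>\<leftarrow>\<eta>s. x \<bullet> \<eta>)) = 0"
  using g zero
proof (induction \<eta>s arbitrary: g)
  case (Cons \<eta> \<eta>s)
  define m where "m = length \<eta>s"
  have "L (\<lambda>x. (g x * (x \<bullet> \<eta>)) * (x \<bullet> \<xi>) ^ m) = 0" for \<xi>
  proof -
    define a where "a j = of_nat (Suc m choose j) * L (\<lambda>x. g x * (x \<bullet> \<eta>) ^ j * (x \<bullet> \<xi>) ^ (Suc m - j))" for j
    have "(\<Sum>j\<le>Suc m. a j * t ^ j) = 0" for t
    proof -
      have "(\<lambda>x. g x * (x \<bullet> (t *\<^sub>R \<eta> + \<xi>)) ^ Suc m) =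
          (\<lambda>x. \<Sum>j\<in>{..Suc m}. (of_nat (Suc m choose j) * t ^ j) *
            (g x * (x \<bullet> \<eta>) ^ j * (x \<bullet> \<xi>) ^ (Suc m - j)))"
        unfolding inner_add_right inner_scaleR_right
        by (subst binomial_ring) (simp only: sum_distrib_left power_mult_distrib mult_ac)
      then have "L (\<lambda>x. g x * (x \<bullet> (t *\<^sub>R \<eta> + \<xi>)) ^ Suc m) =
          (\<Sum>j\<in>{..Suc m}. (of_nat (Suc m choose j) * t ^ j) *
            L (\<lambda>x. g x * (x \<bullet> \<eta>) ^ j * (x \<bullet> \<xi>) ^ (Suc m - j)))"
        using Cons.prems(1) by (simp only:) (rule linear_on_continuous_sum[OF L], auto intro!: continuous_intros)
      moreover have "L (\<lambda>x. g x * (x \<bullet> (t *\<^sub>R \<eta> + \<xi>)) ^ Suc m) = 0"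
        using Cons.prems(2) by (simp add: m_def)
      ultimately show ?thesis
        by (simp add: a_def mult_ac)
    qed
    then have "a 1 = 0"
      using polyfun_eq_0[of a "Suc m"] by force
    then show ?thesis
      by (simp add: a_def)
  qed
  then have "L (\<lambda>x. (g x * (x \<bullet> \<eta>)) * (\<Prod>\<eta>\<leftarrow>\<eta>s. x \<bullet> \<eta>)) = 0"
    using Cons.prems(1) by (intro Cons.IH) (auto intro!: continuous_intros simp: m_def)
  then show ?case
    by (simp add: mult_ac)
qed simp

lemma monomial_fun_eq_prod_list:
  obtains \<eta>s :: "(real^'n::finite) list" where "length \<eta>s = (\<Sum>i\<in>UNIV. a i)"
    and "monomial_fun a = (\<lambda>x. \<Prod>\<eta>\<leftarrow>\<eta>s. x \<bullet> \<eta>)"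
proof -
  obtain js :: "'n list" where js: "set js = UNIV" "distinct js"
    using finite_distinct_list[of "UNIV :: 'n set"] by auto
  define \<eta>s :: "(real^'n) list" where "\<eta>s = concat (map (\<lambda>i. replicate (a i) (axis i 1)) js)"
  have "length \<eta>s = (\<Sum>i\<leftarrow>js. a i)"
    by (simp add: \<eta>s_def length_concat comp_def)
  moreover have "(\<Prod>\<eta>\<leftarrow>\<eta>s. x \<bullet> \<eta>) = (\<Prod>i\<leftarrow>js. (x $ i) ^ a i)" for x
    unfolding \<eta>s_def by (induction js) (auto simp: inner_axis)
  ultimately show ?thesis
    using js by (intro that[of \<eta>s])
      (simp_all add: fun_eq_iff monomial_fun_def sum_list_distinct_conv_sum_set prod.distinct_set_conv_list[symmetric])
qed

lemma continuous_on_monomial_fun: "continuous_on UNIV (monomial_fun a)"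
  unfolding monomial_fun_def by (intro continuous_intros)

lemma finite_multi_indices: "finite (multi_indices t :: ('n::finite \<Rightarrow> nat) set)"
proof (rule finite_subset)
  have "a i \<le> t" if "(\<Sum>i\<in>UNIV. a i) \<le> t" for a :: "'n \<Rightarrow> nat" and i
    using member_le_sum[of i UNIV a] that by simp
  then show "multi_indices t \<subseteq> (UNIV :: 'n set) \<rightarrow>\<^sub>E {..t}"
    by (auto simp: multi_indices_def PiE_def)
qed (simp add: finite_PiE)

text \<open>The defect \<open>L\<close> of the design identity is linear, so it suffices to kill it
  on powers of linear forms and to polarize. There both sides are multiples of
  \<open>norm \<xi> ^ k\<close>, and the unknown constants turn out equal.\<close>

lemma euclidean_design_of_power_sums:
  fixes X :: "(real^'n::{finite,wellorder}) set"
  assumes X: "finite X" and w: "\<And>x. x \<in> X \<Longrightarrow> w x > 0" and t: "t > 0"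
    and power_sums: "\<And>k. k \<le> t \<Longrightarrow> \<exists>c. \<forall>\<xi>. (\<Sum>x\<in>X. w x * (x \<bullet> \<xi>) ^ k) = c * norm \<xi> ^ k"
  shows "euclidean_design X w t"
proof -
  define I where "I f = (\<Sum>r\<in>norm ` X. (\<Sum>x\<in>layer X r. w x) * sphere_avg r f)" for f :: "real^'n::_ \<Rightarrow> real"
  define L where "L f = I f - (\<Sum>x\<in>X. w x * f x)" for f
  \<comment> \<open>Grouping the points by norm removes the sum over layers.\<close>
  have I_eq: "I f = (\<Sum>x\<in>X. w x * sphere_avg (norm x) f)" for f
  proof -
    have "I f = (\<Sum>r\<in>norm ` X. \<Sum>x | x \<in> X \<and> norm x = r. w x * sphere_avg (norm x) f)"
      unfolding I_def layer_def by (intro sum.cong refl) (simp add: sum_distrib_right)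
    also have "\<dots> = (\<Sum>x\<in>X. w x * sphere_avg (norm x) f)"
      using X by (intro sum.group) auto
    finally show ?thesis .
  qed
  have L_add: "L (\<lambda>x. f x + g x) = L f + L g" if "continuous_on UNIV f" "continuous_on UNIV g" for f g
    using that by (simp add: L_def I_eq sphere_avg_add sum.distrib distrib_left)
  have L_cmult: "L (\<lambda>x. c * f x) = c * L f" for c f
    by (simp add: L_def I_eq sphere_avg_cmult sum_distrib_left right_diff_distrib mult_ac)
  have L_power: "L (\<lambda>x. (x \<bullet> \<xi>) ^ k) = 0" if k: "k \<le> t" for k \<xi>
  proof -
    obtain c where c: "\<And>\<xi>. (\<Sum>x\<in>X. w x * (x \<bullet> \<xi>) ^ k) = c * norm \<xi> ^ k"
      using power_sums[OF k] by blast
    obtain A where A: "\<And>r (\<xi> :: real^'n::_). sphere_avg r (\<lambda>x. (x \<bullet> \<xi>) ^ k) = A * (r * norm \<xi>) ^ k"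
      using sphere_avg_inner_power by blast
    \<comment> \<open>Averaging the power sum identity over the unit sphere identifies its constant.\<close>
    have "c = sphere_avg 1 (\<lambda>\<xi>. \<Sum>x\<in>X. w x * (\<xi> \<bullet> x) ^ k)"
      using c by (intro sphere_avg_eq_const[symmetric]) (auto intro!: continuous_intros simp: inner_commute)
    also have "\<dots> = (\<Sum>x\<in>X. w x * (A * norm x ^ k))"
      using X by (subst sphere_avg_sum) (auto intro!: continuous_intros simp: A)
    finally have "c * norm \<xi> ^ k = I (\<lambda>x. (x \<bullet> \<xi>) ^ k)"
      by (simp add: I_eq A sum_distrib_left power_mult_distrib mult_ac)
    then show ?thesis
      by (simp add: L_def c)
  qed
  have L_monomial: "L (monomial_fun a) = 0" if a: "a \<in> multi_indices t" for a
  proof -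
    obtain \<eta>s :: "(real^'n::_) list" where \<eta>s: "length \<eta>s = (\<Sum>i\<in>UNIV. a i)"
      "monomial_fun a = (\<lambda>x. \<Prod>\<eta>\<leftarrow>\<eta>s. x \<bullet> \<eta>)"
      by (rule monomial_fun_eq_prod_list)
    have "L (\<lambda>x. 1 * (\<Prod>\<eta>\<leftarrow>\<eta>s. x \<bullet> \<eta>)) = 0"
      by (rule polarization[of L "\<lambda>_. 1", OF L_add L_cmult])
        (use a L_power in \<open>auto simp: \<eta>s multi_indices_def\<close>)
    then show ?thesis
      by (simp add: \<eta>s)
  qed
  have "L f = 0" if poly: "f \<in> poly_funs t" for f
  proof -
    obtain c where f: "f = (\<lambda>x. \<Sum>a\<in>multi_indices t. c a * monomial_fun a x)"
      using poly by (auto simp: poly_funs_def)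
    show ?thesis
      unfolding f by (subst linear_on_continuous_sum[OF L_add L_cmult]) (auto simp: finite_multi_indices continuous_on_monomial_fun L_monomial)
  qed
  then show ?thesis
    using X w t by (simp add: euclidean_design_def L_def I_def)
qed

section \<open>Cubic polynomials on two spheres\<close>

text \<open>Stars and bars: prepending the slack \<open>t\<close> minus the degree gives the lists
  of length \<open>n + 1\<close> with sum exactly \<open>t\<close>.\<close>

lemma card_multi_indices:
  "card (multi_indices t :: ('n::finite \<Rightarrow> nat) set) = (CARD('n) + t) choose t"
proof -
  obtain js :: "'n list" where js: "set js = UNIV" "distinct js"
    using finite_distinct_list[of "UNIV :: 'n set"] by auto
  have len: "length js = CARD('n)"
    using distinct_card[OF js(2)] js(1) by simp
  have sum_js: "(\<Sum>i\<leftarrow>js. a i) = (\<Sum>i\<in>UNIV. a i)" for a :: "'n \<Rightarrow> nat"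
    using js by (simp add: sum_list_distinct_conv_sum_set)
  let ?f = "\<lambda>a. (t - (\<Sum>i\<in>UNIV. a i)) # map a js"
  let ?L = "{l :: nat list. length l = Suc CARD('n) \<and> sum_list l = t}"
  have "bij_betw ?f (multi_indices t) ?L"
  proof (rule bij_betw_imageI)
    show "inj_on ?f (multi_indices t)"
      using js by (auto simp: inj_on_def fun_eq_iff)
    show "?f ` multi_indices t = ?L"
    proof
      show "?f ` multi_indices t \<subseteq> ?L"
        by (auto simp: multi_indices_def len sum_js)
      show "?L \<subseteq> ?f ` multi_indices t"
      proof
        fix l assume "l \<in> ?L"
        then obtain x l' where l: "l = x # l'" "length l' = length js" "x + sum_list l' = t"
          by (cases l) (auto simp: len)
        define a where "a i = the (map_of (zip js l') i)" for i
        have a: "map a js = l'"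
          using l js by (intro nth_equalityI) (auto simp: a_def map_of_zip_nth)
        then have "sum_list l' = (\<Sum>i\<in>UNIV. a i)"
          using sum_js[of a] by simp
        with l a show "l \<in> ?f ` multi_indices t"
          by (intro image_eqI[of _ _ a]) (auto simp: multi_indices_def)
      qed
    qed
  qed
  then have "card (multi_indices t :: ('n \<Rightarrow> nat) set) = card ?L"
    by (rule bij_betw_same_card)
  then show ?thesis
    by (simp add: card_length_sum_list add.commute)
qed

text \<open>The last digit is the residue modulo \<open>b\<close>; the others follow by induction.
  This reads exponents back from Kronecker's substitution.\<close>

lemma digits_unique:
  fixes a a' :: "nat \<Rightarrow> nat"
  assumes "(\<Sum>k<n. a k * b ^ k) = (\<Sum>k<n. a' k * b ^ k)"
    and "\<And>k. k < n \<Longrightarrow> a k < b" "\<And>k. k < n \<Longrightarrow> a' k < b" and "k < n"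
  shows "a k = a' k"
  using assms
proof (induction n arbitrary: a a' k)
  case (Suc n)
  have shift: "(\<Sum>k<Suc n. c k * b ^ k) = c 0 + b * (\<Sum>k<n. c (Suc k) * b ^ k)" for c :: "nat \<Rightarrow> nat"
    by (simp only: sum.lessThan_Suc_shift sum_distrib_left) (simp add: mult_ac)
  have eq: "a 0 + b * (\<Sum>k<n. a (Suc k) * b ^ k) = a' 0 + b * (\<Sum>k<n. a' (Suc k) * b ^ k)"
    using Suc.prems(1) unfolding shift .
  have lt: "a 0 < b" "a' 0 < b"
    using Suc.prems by auto
  have "a 0 = a' 0"
    using arg_cong[OF eq, of "\<lambda>x. x mod b"] lt by simp
  moreover have "(\<Sum>k<n. a (Suc k) * b ^ k) = (\<Sum>k<n. a' (Suc k) * b ^ k)"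
    using eq calculation lt by simp
  then have "a (Suc j) = a' (Suc j)" if "j < n" for j
    using Suc.IH[of "\<lambda>k. a (Suc k)" "\<lambda>k. a' (Suc k)" j] Suc.prems that by simp
  ultimately show ?case
    using Suc.prems(4) by (cases k) auto
qed simp

text \<open>Kronecker's substitution \<open>x\<^sub>i = z ^ ((t + 1) ^ i)\<close> turns distinct monomials
  of degree at most \<open>t\<close> into distinct powers of \<open>z\<close>.\<close>
lemma monomial_funs_independent:
  fixes c :: "('n::finite \<Rightarrow> nat) \<Rightarrow> real"
  assumes zero: "\<And>x. (\<Sum>a\<in>multi_indices t. c a * monomial_fun a x) = 0"
    and a: "a \<in> multi_indices t"
  shows "c a = 0"
proof -
  obtain e :: "'n \<Rightarrow> nat" where e: "bij_betw e UNIV {..<CARD('n)}"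
    using ex_bij_betw_finite_nat[of "UNIV :: 'n set"] by (auto simp: atLeast0LessThan)
  define M where "M = (multi_indices t :: ('n \<Rightarrow> nat) set)"
  define \<phi> where "\<phi> a = (\<Sum>i\<in>UNIV. a i * (t + 1) ^ e i)" for a :: "'n \<Rightarrow> nat"
  have fin: "finite M"
    by (simp add: M_def finite_multi_indices)
  have le: "b i < t + 1" if "b \<in> M" for b i
    using that member_le_sum[of i UNIV b] by (auto simp: M_def multi_indices_def)
  have \<phi>_eq: "\<phi> b = (\<Sum>k<CARD('n). b (the_inv e k) * (t + 1) ^ k)" for b
    unfolding \<phi>_def using e
    by (subst sum.reindex_bij_betw[OF e, symmetric]) (auto simp: bij_betw_def the_inv_f_f)
  have inj: "b = b'" if "b \<in> M" "b' \<in> M" "\<phi> b = \<phi> b'" for b b'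
  proof
    fix i
    have "e i < CARD('n)"
      using e by (auto simp: bij_betw_def)
    then have "b (the_inv e (e i)) = b' (the_inv e (e i))"
      using digits_unique[OF that(3)[unfolded \<phi>_eq]] le[OF that(1)] le[OF that(2)] by simp
    then show "b i = b' i"
      using e by (simp add: bij_betw_def the_inv_f_f)
  qed
  define N where "N = Max (\<phi> ` M)"
  define d where "d j = (\<Sum>b | b \<in> M \<and> \<phi> b = j. c b)" for j
  have "(\<Sum>j\<le>N. d j * z ^ j) = 0" for z
  proof -
    define x :: "real^'n" where "x = (\<chi> i. z ^ ((t + 1) ^ e i))"
    have mono: "monomial_fun b x = z ^ \<phi> b" for b
      unfolding monomial_fun_def x_def \<phi>_def
      by (simp add: power_mult[symmetric] power_sum mult.commute)
    have "(\<Sum>j\<le>N. d j * z ^ j) = (\<Sum>j\<le>N. \<Sum>b | b \<in> M \<and> \<phi> b = j. c b * z ^ \<phi> b)"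
      by (intro sum.cong refl) (simp add: d_def sum_distrib_right)
    also have "\<dots> = (\<Sum>b\<in>M. c b * z ^ \<phi> b)"
      using fin by (intro sum.group) (auto simp: N_def)
    also have "\<dots> = 0"
      using zero[of x] by (simp add: mono M_def)
    finally show ?thesis .
  qed
  then have "d (\<phi> a) = 0"
    using polyfun_eq_0[of d N] fin a by (auto simp: N_def M_def)
  moreover have "{b. b \<in> M \<and> \<phi> b = \<phi> a} = {a}"
    using inj a by (auto simp: M_def)
  ultimately show ?thesis
    by (simp add: d_def)
qed

lemma cubic_zero_of_four_roots:
  fixes b :: "nat \<Rightarrow> real"
  assumes r: "0 < r1" "r1 < r2"
    and roots: "\<And>z. z \<in> {r1, - r1, r2, - r2} \<Longrightarrow> (\<Sum>k\<le>3. b k * z ^ k) = 0"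
  shows "(\<Sum>k\<le>3. b k * z ^ k) = 0"
proof -
  have "b k = 0" if "k \<le> 3" for k
  proof (rule ccontr)
    assume "b k \<noteq> 0"
    then have "finite {z. (\<Sum>k\<le>3. b k * z ^ k) = 0}" "card {z. (\<Sum>k\<le>3. b k * z ^ k) = 0} \<le> 3"
      using Poly_Roots.polyfun_rootbound[of 3 b] that by auto
    moreover have "{r1, - r1, r2, - r2} \<subseteq> {z. (\<Sum>k\<le>3. b k * z ^ k) = 0}"
      using roots by blast
    ultimately have "card {r1, - r1, r2, - r2} \<le> 3"
      by (meson card_mono le_trans)
    moreover have "card {r1, - r1, r2, - r2} = 4"
      using r by simp
    ultimately show False
      by simp
  qed
  then show ?thesis
    by simp
qed

lemma monomial_fun_scaleR: "monomial_fun a (z *\<^sub>R u) = z ^ (\<Sum>i\<in>UNIV. a i) * monomial_fun a u"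
  by (simp add: monomial_fun_def power_mult_distrib prod.distrib power_sum)

lemma cubic_zero_of_two_spheres:
  fixes c :: "('n::finite \<Rightarrow> nat) \<Rightarrow> real"
  assumes r: "0 < r1" "r1 < r2"
    and zero: "\<And>x. norm x \<in> {r1, r2} \<Longrightarrow> (\<Sum>a\<in>multi_indices 3. c a * monomial_fun a x) = 0"
    and a: "a \<in> multi_indices 3"
  shows "c a = 0"
proof (rule monomial_funs_independent[OF _ a])
  fix x :: "real^'n"
  obtain u :: "real^'n" and z where u: "norm u = 1" "x = z *\<^sub>R u"
  proof (cases "x = 0")
    case True
    then show ?thesis
      using that[of "axis undefined 1" 0] by simp
  next
    case False
    then show ?thesis
      using that[of "x /\<^sub>R norm x" "norm x"] by simp
  qed
  \<comment> \<open>\<open>b k\<close> is the value at \<open>u\<close> of the homogeneous part of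
    degree \<open>k\<close>, so on the line through \<open>u\<close> the polynomial is a cubic in
    \<open>z\<close>.\<close>
  define b where "b k = (\<Sum>a | a \<in> multi_indices 3 \<and> (\<Sum>i\<in>UNIV. a i) = k. c a * monomial_fun a u)" for k
  have eq: "(\<Sum>a\<in>multi_indices 3. c a * monomial_fun a (z *\<^sub>R u)) = (\<Sum>k\<le>3. b k * z ^ k)" for z
  proof -
    have "(\<Sum>k\<le>3. b k * z ^ k) = (\<Sum>k\<le>3. \<Sum>a | a \<in> multi_indices 3 \<and> (\<Sum>i\<in>UNIV. a i) = k.
        c a * monomial_fun a (z *\<^sub>R u))"
      by (intro sum.cong refl) (simp add: b_def sum_distrib_left monomial_fun_scaleR mult_ac)
    also have "\<dots> = (\<Sum>a\<in>multi_indices 3. c a * monomial_fun a (z *\<^sub>R u))"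
      by (intro sum.group) (auto simp: finite_multi_indices, auto simp: multi_indices_def)
    finally show ?thesis
      by simp
  qed
  have "(\<Sum>k\<le>3. b k * z ^ k) = 0"
  proof (rule cubic_zero_of_four_roots[OF r])
    fix z assume "z \<in> {r1, - r1, r2, - r2}"
    then have "norm (z *\<^sub>R u) \<in> {r1, r2}"
      using r u by auto
    then show "(\<Sum>k\<le>3. b k * z ^ k) = 0"
      using zero by (simp flip: eq)
  qed
  then show "(\<Sum>a\<in>multi_indices 3. c a * monomial_fun a x) = 0"
    by (simp add: u eq)
qed

text \<open>The restricted monomials span the space and are independent by
  \<open>cubic_zero_of_two_spheres\<close>, so the dimension is the number of multi-indices.\<close>

lemma dim_PeS_two_spheres:
  fixes S :: "(real^'n::finite) set"
  assumes r: "0 < r1" "r1 < r2" and S: "S = {y. norm y \<in> {r1, r2}}"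
  shows "dim_PeS 3 S = (CARD('n) + 3) choose 3"
proof -
  interpret vs: vector_space "\<lambda>(c::real) (f :: real^'n \<Rightarrow> real) x. c * f x"
    by unfold_locales (auto simp: fun_eq_iff algebra_simps)
  define M where "M = (multi_indices 3 :: ('n \<Rightarrow> nat) set)"
  define res where "res f = (\<lambda>x. if x \<in> S then f x else (0::real))" for f
  define m where "m a = res (monomial_fun a)" for a
  have fin: "finite M"
    by (simp add: M_def finite_multi_indices)
  have sum_apply: "(\<Sum>a\<in>A. f a) x = (\<Sum>a\<in>A. f a x)" for A and f :: "('n \<Rightarrow> nat) \<Rightarrow> real^'n \<Rightarrow> real" and x
    by (induction A rule: infinite_finite_induct) auto
  have res_sum: "res (\<lambda>x. \<Sum>a\<in>M. c a * monomial_fun a x) = (\<Sum>a\<in>M. (\<lambda>x. c a * m a x))" for c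
    by (auto simp: fun_eq_iff sum_apply res_def m_def)
  have zero: "c a = 0" if "(\<Sum>a\<in>M. (\<lambda>x. c a * m a x)) = 0" "a \<in> M" for c a
  proof (rule cubic_zero_of_two_spheres[OF r, of c])
    fix x :: "real^'n" assume "norm x \<in> {r1, r2}"
    then have "x \<in> S"
      by (simp add: S)
    then show "(\<Sum>a\<in>multi_indices 3. c a * monomial_fun a x) = 0"
      using fun_cong[OF that(1)[folded res_sum], of x] by (simp add: res_def M_def)
  qed (use that in \<open>simp add: M_def\<close>)
  \<comment> \<open>Two monomials with the same restriction would give a vanishing combination with
    coefficients 1 and -1.\<close>
  have inj: "inj_on m M"
  proof (rule inj_onI, rule ccontr)
    fix a b assume ab: "a \<in> M" "b \<in> M" "m a = m b" "a \<noteq> b"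
    define c where "c d = (if d = a then 1 else if d = b then - 1 else (0::real))" for d
    have "(\<Sum>d\<in>M. c d * m d x) = (\<Sum>d\<in>{a, b}. c d * m d x)" for x
      using fin ab by (intro sum.mono_neutral_right) (auto simp: c_def)
    then have "(\<Sum>d\<in>M. (\<lambda>x. c d * m d x)) = 0"
      using ab by (auto simp: fun_eq_iff sum_apply c_def)
    then have "c a = 0"
      using zero ab by blast
    then show False
      by (simp add: c_def)
  qed
  have indep: "vs.independent (m ` M)"
  proof (rule vs.independent_if_scalars_zero)
    fix f v assume "(\<Sum>v\<in>m ` M. (\<lambda>x. f v * v x)) = 0" "v \<in> m ` M"
    then show "f v = 0"
      using zero[of "\<lambda>a. f (m a)"] by (auto simp: sum.reindex[OF inj])
  qed (simp add: fin)
  have "vs.dim (res ` poly_funs 3) = card (m ` M)"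
  proof (rule vs.dim_unique[OF _ _ indep refl])
    show "m ` M \<subseteq> res ` poly_funs 3"
    proof
      fix v assume "v \<in> m ` M"
      then obtain a where a: "a \<in> M" "v = m a"
        by auto
      have "monomial_fun a = (\<lambda>x. \<Sum>b\<in>M. (if b = a then 1 else 0) * monomial_fun b x)"
        using fin a by (simp add: if_distrib[of "\<lambda>c. c * _"] cong: if_cong)
      then have "monomial_fun a \<in> poly_funs 3"
        unfolding poly_funs_def M_def by (intro CollectI exI)
      then show "v \<in> res ` poly_funs 3"
        by (auto simp: a m_def)
    qed
    show "res ` poly_funs 3 \<subseteq> vs.span (m ` M)"
    proof
      fix v assume "v \<in> res ` poly_funs 3"
      then obtain c where "v = res (\<lambda>x. \<Sum>a\<in>M. c a * monomial_fun a x)"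
        by (auto simp: poly_funs_def M_def)
      then show "v \<in> vs.span (m ` M)"
        unfolding res_sum by (simp only:) (intro vs.span_sum vs.span_scale vs.span_base imageI)
    qed
  qed
  then show ?thesis
    using card_image[OF inj] by (simp add: dim_PeS_def res_def[abs_def] M_def card_multi_indices)
qed

section \<open>The code and the hexads\<close>

definition word :: "nat set \<Rightarrow> bool list" where
  "word T = map (\<lambda>i. i \<in> T) [0..<22]"

text \<open>The coordinates \<open>0, \<dots>, 21\<close> stand for the nonzero residues \<open>5 ^ n\<close> modulo 23, the other two
  coordinates of the extended binary Golay code, in its form as a quadratic residue code, being
  \<open>0\<close> and \<open>\<infinity>\<close>. The hexads are the octads through \<open>0\<close> and \<open>\<infinity>\<close>; multiplication by
  \<open>2 = 5 ^ 2\<close> permutes them in cycles of length 11. \<open>code_gens\<close> is the systematic basis of the Golay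
  words avoiding \<open>0\<close> and \<open>\<infinity>\<close>, and \<open>code_shift\<close> is a Golay word containing \<open>\<infinity>\<close> but not \<open>0\<close>.\<close>
definition hexad_reps :: "nat list list" where
  "hexad_reps =
    [[0, 1, 2, 3, 8, 17],
     [0, 1, 4, 5, 13, 14],
     [0, 1, 7, 11, 12, 16],
     [0, 2, 4, 12, 15, 18],
     [0, 2, 5, 6, 9, 11],
     [0, 2, 7, 14, 19, 21],
     [0, 3, 11, 13, 15, 19]]"

definition code_gens :: "bool list list" where
  "code_gens = map (\<lambda>xs. word (set xs))
    [[0, 10, 11, 13, 17, 18, 19, 20],
     [1, 10, 14, 15, 16, 17, 18, 19],
     [2, 10, 11, 12, 15, 17, 18, 21],
     [3, 12, 16, 17, 18, 19, 20, 21],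
     [4, 10, 12, 13, 15, 16, 18, 20],
     [5, 11, 13, 15, 16, 18, 19, 21],
     [6, 10, 11, 12, 13, 14, 15, 19],
     [7, 10, 13, 14, 16, 19, 20, 21],
     [8, 12, 13, 14, 15, 16, 17, 21],
     [9, 11, 12, 13, 14, 18, 20, 21]]"

definition code_shift :: "bool list" where
  "code_shift = word {10, 11, 12, 14, 16, 17, 20}"

definition hexads :: "nat list list" where
  "hexads = [map (\<lambda>x. (x + 2 * k) mod 22) h. h \<leftarrow> hexad_reps, k \<leftarrow> [0..<11]]"

text \<open>The parity check matrix \<open>(A^T | I)\<close> belonging to the systematic generator
  matrix \<open>(I | A)\<close> of the code: column \<open>f\<close> of \<open>A\<close>, followed
  by a unit vector on the last twelve coordinates.\<close>

definition dual_gens :: "bool list list" where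
  "dual_gens = map (\<lambda>f. map (\<lambda>g. g ! f) code_gens @ map (\<lambda>i. i = f) [10..<22]) [10..<22]"

definition xor_word :: "bool list \<Rightarrow> bool list \<Rightarrow> bool list" where
  "xor_word = map2 (\<noteq>)"

definition weight :: "bool list \<Rightarrow> nat" where
  "weight w = length (filter id w)"

fun dot :: "bool list \<Rightarrow> bool list \<Rightarrow> bool" where
  "dot (a # as) (b # bs) = ((a \<and> b) \<noteq> dot as bs)"
| "dot _ _ = False"

fun coset :: "bool list \<Rightarrow> bool list list \<Rightarrow> bool list list" where
  "coset c [] = [c]"
| "coset c (g # gs) = coset c gs @ coset (xor_word c g) gs"

text \<open>Counts inside \<open>coset c gs\<close> without ever building that list, which keeps evaluation by
  rewriting fast.\<close>
fun tally :: "(bool list \<Rightarrow> bool) \<Rightarrow> bool list \<Rightarrow> bool list list \<Rightarrow> nat" where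
  "tally P c [] = (if P c then 1 else 0)"
| "tally P c (g # gs) = tally P c gs + tally P (xor_word c g) gs"

text \<open>A certificate of linear independence that can be evaluated: each row has a pivot that
  all later rows avoid.\<close>

fun echelon :: "bool list list \<Rightarrow> bool" where
  "echelon [] = True"
| "echelon (g # gs) = ((\<exists>j\<in>set [0..<22]. g ! j \<and> (\<forall>h\<in>set gs. \<not> h ! j)) \<and> echelon gs)"

section \<open>Cosets of binary codes and evaluated certificates\<close>

lemma tally_eq: "tally P c gs = length (filter P (coset c gs))"
  by (induction gs arbitrary: c) auto

lemma length_word [simp]: "length (word T) = 22"
  by (simp add: word_def)

lemma nth_word [simp]: "i < 22 \<Longrightarrow> word T ! i \<longleftrightarrow> i \<in> T"
  by (simp add: word_def)

lemma length_xor_word [simp]: "length (xor_word c g) = min (length c) (length g)"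
  by (simp add: xor_word_def)

lemma nth_xor_word: "i < length c \<Longrightarrow> i < length g \<Longrightarrow> xor_word c g ! i \<longleftrightarrow> c ! i \<noteq> g ! i"
  by (simp add: xor_word_def)

lemma length_coset:
  assumes "length c = 22" "\<forall>g\<in>set gs. length g = 22" "w \<in> set (coset c gs)"
  shows "length w = 22"
  using assms
proof (induction gs arbitrary: c)
  case (Cons g gs)
  then show ?case
    using Cons.IH[of c] Cons.IH[of "xor_word c g"] by auto
qed simp

lemma nth_coset:
  assumes "length c = 22" "\<forall>g\<in>set gs. length g = 22 \<and> \<not> g ! j" "j < 22" "w \<in> set (coset c gs)"
  shows "w ! j \<longleftrightarrow> c ! j"
  using assms
proof (induction gs arbitrary: c)
  case (Cons g gs)
  then show ?case
    using Cons.IH[of c] Cons.IH[of "xor_word c g"] by (auto simp: nth_xor_word)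
qed simp

lemma distinct_coset:
  assumes "length c = 22" "\<forall>g\<in>set gs. length g = 22" "echelon gs"
  shows "distinct (coset c gs)"
  using assms
proof (induction gs arbitrary: c)
  case (Cons g gs)
  then obtain j where j: "j < 22" "g ! j" "\<forall>h\<in>set gs. \<not> h ! j"
    by auto
  have "w ! j \<longleftrightarrow> c ! j" if "w \<in> set (coset c gs)" for w
    using Cons.prems j that by (intro nth_coset) auto
  moreover have "w ! j \<longleftrightarrow> \<not> c ! j" if "w \<in> set (coset (xor_word c g) gs)" for w
    using Cons.prems j that nth_coset[of "xor_word c g" gs j w] by (simp add: nth_xor_word)
  ultimately show ?case
    using Cons by auto
qed simp

lemma length_code_gens: "\<forall>g\<in>set code_gens. length g = 22"
  by (auto simp: code_gens_def)

lemma length_code_shift [simp]: "length code_shift = 22"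
  by (simp add: code_shift_def)

lemma length_dual_gens: "\<forall>g\<in>set dual_gens. length g = 22"
  by (auto simp: dual_gens_def code_gens_def)

lemma echelon_code_gens: "echelon code_gens"
  by code_simp

lemma echelon_dual_gens: "echelon dual_gens"
  by code_simp

lemma distinct_word_hexads: "distinct (map (\<lambda>h. word (set h)) hexads)"
  by code_simp

lemma hexads_length: "length hexads = 77"
  by code_simp

text \<open>A hexad meets every code generator evenly and the shift oddly, so its character is
  constantly -1 on the coset.\<close>

lemma hexads_dot:
  "\<forall>h\<in>set hexads. (\<forall>g\<in>set code_gens. \<not> dot (word (set h)) g) \<and> dot (word (set h)) code_shift"
  by code_simp

lemma hexads_bounded: "\<forall>h\<in>set hexads. distinct h \<and> length h = 6 \<and> (\<forall>i\<in>set h. i < 22)"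
  by code_simp

lemma tally_code:
  "tally (\<lambda>w. weight w = 7) code_shift code_gens = 176"
  "tally (\<lambda>w. weight w = 11) code_shift code_gens = 672"
  "tally (\<lambda>w. weight w = 15) code_shift code_gens = 176"
  by code_simp+

text \<open>78 = 1 + 77 leaves room for the zero word and the hexads only.\<close>

lemma tally_dual: "tally (\<lambda>w. weight w \<le> 6) (word {}) dual_gens = 78"
  by code_simp

section \<open>Verification of the Steiner system\<close>

definition through :: "nat \<Rightarrow> nat list list \<Rightarrow> nat list list" where
  "through i = filter (\<lambda>h. i \<in> set h)"

definition pairs_ok :: "nat \<Rightarrow> nat list list \<Rightarrow> bool" where
  "pairs_ok j L \<longleftrightarrow> length L = 5 \<and> (\<forall>k\<in>set [0..<22]. j < k \<longrightarrow> length (through k L) = 1)"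

definition points_ok :: "nat \<Rightarrow> nat list list \<Rightarrow> bool" where
  "points_ok i L \<longleftrightarrow> length L = 21 \<and> (\<forall>j\<in>set [0..<22]. i < j \<longrightarrow> pairs_ok j (through j L))"

text \<open>There are 21, 5 and 1 hexads through one, two and three points. Nested filters reuse the
  shorter lists, and by symmetry increasing triples suffice.\<close>

lemma hexads_points_ok: "\<forall>i\<in>set [0..<22]. points_ok i (through i hexads)"
  by code_simp

text \<open>Masking each entry by the bit \<open>b\<close>, instead of branching on it, lets a
  combination with symbolic coefficients be simplified.\<close>

fun comb :: "bool list \<Rightarrow> bool list \<Rightarrow> bool list list \<Rightarrow> bool list" where
  "comb c (b # bs) (g # gs) = comb (map2 (\<lambda>x y. x \<noteq> (b \<and> y)) c g) bs gs"
| "comb c _ _ = c"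

lemma comb_in_coset:
  assumes "length bs = length gs" "length c = 22" "\<forall>g\<in>set gs. length g = 22"
  shows "comb c bs gs \<in> set (coset c gs)"
  using assms
proof (induction bs gs arbitrary: c rule: list_induct2)
  case (Cons b bs g gs)
  have "map2 (\<lambda>x y. x) c g = c"
    using Cons.prems by (intro nth_equalityI) auto
  then show ?case
    using Cons by (cases b) (auto simp: xor_word_def)
qed simp

text \<open>With the 22 bits as propositional atoms, orthogonality becomes a family of parity
  formulas.\<close>

lemma word_explicit: "word T = [0 \<in> T, 1 \<in> T, 2 \<in> T, 3 \<in> T, 4 \<in> T, 5 \<in> T, 6 \<in> T, 7 \<in> T,
    8 \<in> T, 9 \<in> T, 10 \<in> T, 11 \<in> T, 12 \<in> T, 13 \<in> T, 14 \<in> T, 15 \<in> T, 16 \<in> T, 17 \<in> T,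
    18 \<in> T, 19 \<in> T, 20 \<in> T, 21 \<in> T]"
proof -
  have "[0..<22] = [0, 1, 2, 3, 4, 5, 6, 7, 8, 9, 10, 11, 12, 13, 14, 15, 16, 17, 18, 19, 20, 21]"
    by code_simp
  then show ?thesis
    by (simp add: word_def)
qed

text \<open>The identity block of \<open>dual_gens\<close> makes the last twelve bits of the word
  the coefficients; orthogonality to the systematic generators then fixes the first ten.\<close>

lemma dual_in_coset:
  assumes "\<forall>g\<in>set code_gens. \<not> dot (word T) g"
  shows "word T \<in> set (coset (word {}) dual_gens)"
proof -
  have "comb (word {}) (drop 10 (word T)) dual_gens = word T"
    using assms by (simp add: code_gens_def dual_gens_def word_explicit) (intro conjI; argo)
  moreover have "length dual_gens = 12"
    by (simp add: dual_gens_def)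
  ultimately show ?thesis
    using comb_in_coset[of "drop 10 (word T)" dual_gens "word {}"] length_dual_gens by simp
qed

section \<open>Sums over signs\<close>

definition sgn_of :: "bool \<Rightarrow> real" where
  "sgn_of b = (if b then - 1 else 1)"

lemma sgn_of_sq [simp]: "sgn_of b * sgn_of b = 1"
  by (simp add: sgn_of_def)

text \<open>The shift \<open>x\<close> makes the induction close: the sign of a new element
  \<open>a\<close> replaces \<open>x\<close> by \<open>x + v a\<close> or
  \<open>x - v a\<close>.\<close>

lemma rademacher_sextic:
  fixes v :: "'a \<Rightarrow> real"
  assumes "finite A"
  shows "(\<Sum>S\<in>Pow A. (x + (\<Sum>i\<in>A. sgn_of (i \<in> S) * v i)) ^ 6) =
    2 ^ card A * (x ^ 6 + 15 * x ^ 4 * (\<Sum>i\<in>A. v i ^ 2)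
      + 15 * x ^ 2 * (3 * (\<Sum>i\<in>A. v i ^ 2) ^ 2 - 2 * (\<Sum>i\<in>A. v i ^ 4))
      + 15 * (\<Sum>i\<in>A. v i ^ 2) ^ 3 - 30 * (\<Sum>i\<in>A. v i ^ 2) * (\<Sum>i\<in>A. v i ^ 4)
      + 16 * (\<Sum>i\<in>A. v i ^ 6))"
  using assms
proof (induction A arbitrary: x rule: finite_induct)
  case (insert a A)
  define p2 where "p2 = (\<Sum>i\<in>A. v i ^ 2)"
  define p4 where "p4 = (\<Sum>i\<in>A. v i ^ 4)"
  define p6 where "p6 = (\<Sum>i\<in>A. v i ^ 6)"
  let ?F = "\<lambda>x S. (x + (\<Sum>i\<in>A. sgn_of (i \<in> S) * v i)) ^ 6"
  have disj: "Pow A \<inter> insert a ` Pow A = {}"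
    using insert.hyps by auto
  have inj: "inj_on (insert a) (Pow A)"
    using insert.hyps by (auto simp: inj_on_def)
  have 1: "(x + (\<Sum>i\<in>insert a A. sgn_of (i \<in> S) * v i)) ^ 6 = ?F (x + v a) S" if "S \<in> Pow A" for S
    using insert.hyps that by (auto simp: sgn_of_def algebra_simps)
  have 2: "(x + (\<Sum>i\<in>insert a A. sgn_of (i \<in> insert a S) * v i)) ^ 6 = ?F (x - v a) S" for S
  proof -
    have "(\<Sum>i\<in>A. sgn_of (i \<in> insert a S) * v i) = (\<Sum>i\<in>A. sgn_of (i \<in> S) * v i)"
      using insert.hyps by (intro sum.cong refl) (auto simp: sgn_of_def)
    then show ?thesis
      using insert.hyps by (simp add: sgn_of_def algebra_simps)
  qed
  have "(\<Sum>S\<in>Pow (insert a A). (x + (\<Sum>i\<in>insert a A. sgn_of (i \<in> S) * v i)) ^ 6) =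
      (\<Sum>S\<in>Pow A. ?F (x + v a) S) + (\<Sum>S\<in>Pow A. ?F (x - v a) S)"
  proof -
    let ?H = "\<lambda>S. (x + (\<Sum>i\<in>insert a A. sgn_of (i \<in> S) * v i)) ^ 6"
    have "(\<Sum>S\<in>Pow (insert a A). ?H S) = (\<Sum>S\<in>Pow A. ?H S) + (\<Sum>S\<in>insert a ` Pow A. ?H S)"
      unfolding Pow_insert using insert.hyps disj by (intro sum.union_disjoint) auto
    also have "(\<Sum>S\<in>insert a ` Pow A. ?H S) = (\<Sum>S\<in>Pow A. ?F (x - v a) S)"
      by (subst sum.reindex[OF inj]) (simp only: comp_def 2)
    also have "(\<Sum>S\<in>Pow A. ?H S) = (\<Sum>S\<in>Pow A. ?F (x + v a) S)"
      by (intro sum.cong refl 1)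
    finally show ?thesis .
  qed
  also have "\<dots> = 2 ^ card (insert a A) * (x ^ 6 + 15 * x ^ 4 * (v a ^ 2 + p2)
      + 15 * x ^ 2 * (3 * (v a ^ 2 + p2) ^ 2 - 2 * (v a ^ 4 + p4))
      + 15 * (v a ^ 2 + p2) ^ 3 - 30 * (v a ^ 2 + p2) * (v a ^ 4 + p4)
      + 16 * (v a ^ 6 + p6))"
    unfolding insert.IH p2_def[symmetric] p4_def[symmetric] p6_def[symmetric]
    unfolding card_insert_disjoint[OF insert.hyps] power_Suc by algebra
  finally show ?case
    using insert.hyps by (simp add: p2_def p4_def p6_def)
qed simp

text \<open>The sum factors over \<open>A\<close>, and every element of \<open>T\<close> contributes
  the factor 1 - 1.\<close>

lemma sum_Pow_sgn_of:
  assumes "finite A" "T \<subseteq> A"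
  shows "(\<Sum>S\<in>Pow A. \<Prod>i\<in>T. sgn_of (i \<in> S)) = (if T = {} then 2 ^ card A else 0)"
proof -
  have "(\<Sum>S\<in>Pow A. \<Prod>i\<in>T. sgn_of (i \<in> S)) =
      (\<Sum>S\<in>Pow A. (\<Prod>i\<in>S. if i \<in> T then - 1 else 1) * (\<Prod>i\<in>A - S. 1))"
  proof (intro sum.cong refl)
    fix S assume S: "S \<in> Pow A"
    have "(\<Prod>i\<in>T. sgn_of (i \<in> S)) = (\<Prod>i\<in>A. if i \<in> S \<and> i \<in> T then - 1 else 1)"
      using assms by (intro prod.mono_neutral_cong_left) (auto simp: sgn_of_def)
    also have "\<dots> = (\<Prod>i\<in>S. if i \<in> T then - 1 else 1)"
      using assms S by (intro prod.mono_neutral_cong_right) auto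
    finally show "(\<Prod>i\<in>T. sgn_of (i \<in> S)) = (\<Prod>i\<in>S. if i \<in> T then - 1 else 1) * (\<Prod>i\<in>A - S. 1)"
      by simp
  qed
  also have "\<dots> = (\<Prod>i\<in>A. (if i \<in> T then - 1 else 1) + 1)"
    using assms by (simp add: prod_add)
  also have "\<dots> = (if T = {} then 2 ^ card A else 0)"
    using assms by (auto simp: prod_zero_iff intro!: prod_zero)
  finally show ?thesis .
qed

text \<open>Symmetric difference with \<open>{i}\<close>: since signs square to 1, multiplying a
  character by the sign of \<open>i\<close> toggles \<open>i\<close> in its index set.\<close>

definition toggle :: "'a \<Rightarrow> 'a set \<Rightarrow> 'a set" where
  "toggle i T = (if i \<in> T then T - {i} else insert i T)"

lemma toggle_toggle [simp]: "toggle i (toggle i T) = T"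
  by (auto simp: toggle_def)

text \<open>The coefficient of the character \<open>\<Prod>i\<in>T. \<epsilon> i\<close> in \<open>(x + (\<Sum>i\<in>A. \<epsilon> i * v i)) ^ k\<close>.\<close>
fun fourier :: "'a set \<Rightarrow> real \<Rightarrow> ('a \<Rightarrow> real) \<Rightarrow> nat \<Rightarrow> 'a set \<Rightarrow> real" where
  "fourier A x v 0 T = (if T = {} then 1 else 0)"
| "fourier A x v (Suc k) T = x * fourier A x v k T + (\<Sum>i\<in>A. v i * fourier A x v k (toggle i T))"

lemma prod_toggle:
  fixes e :: "'a \<Rightarrow> real"
  assumes "finite T" "e i * e i = 1"
  shows "(\<Prod>j\<in>toggle i T. e j) = e i * (\<Prod>j\<in>T. e j)"
proof (cases "i \<in> T")
  case True
  then have "(\<Prod>j\<in>T. e j) = e i * (\<Prod>j\<in>T - {i}. e j)"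
    using assms by (simp add: prod.remove)
  then show ?thesis
    using True assms by (simp add: toggle_def mult.assoc[symmetric])
qed (use assms in \<open>simp add: toggle_def\<close>)

lemma power_eq_fourier:
  assumes A: "finite A" and e: "\<And>i. i \<in> A \<Longrightarrow> e i * e i = 1"
  shows "(x + (\<Sum>i\<in>A. e i * v i)) ^ k = (\<Sum>T\<in>Pow A. fourier A x v k T * (\<Prod>i\<in>T. e i))"
proof (induction k)
  case 0
  have "(\<Sum>T\<in>Pow A. fourier A x v 0 T * (\<Prod>i\<in>T. e i)) = (\<Sum>T\<in>{{}}. fourier A x v 0 T * (\<Prod>i\<in>T. e i))"
    using A by (intro sum.mono_neutral_right) auto
  then show ?case
    by simp
next
  case (Suc k)
  define G where "G T = (\<Prod>i\<in>T. e i)" for T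
  define m where "m = fourier A x v k"
  have bij: "bij_betw (toggle i) (Pow A) (Pow A)" if "i \<in> A" for i
    using that by (intro bij_betw_byWitness[where f' = "toggle i"]) (auto simp: toggle_def)
  \<comment> \<open>Multiplication by \<open>e i\<close> permutes the characters by an involution;
    reindexing moves it to the coefficients.\<close>
  have step: "e i * (\<Sum>T\<in>Pow A. m T * G T) = (\<Sum>T\<in>Pow A. m (toggle i T) * G T)" if i: "i \<in> A" for i
  proof -
    have "e i * (\<Sum>T\<in>Pow A. m T * G T) = (\<Sum>T\<in>Pow A. m T * G (toggle i T))"
      unfolding sum_distrib_left G_def
      using A e[OF i] by (intro sum.cong) (auto simp: prod_toggle finite_subset)
    also have "\<dots> = (\<Sum>T\<in>Pow A. m (toggle i T) * G (toggle i (toggle i T)))"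
      by (rule sum.reindex_bij_betw[OF bij[OF i], symmetric])
    finally show ?thesis
      by simp
  qed
  have "(x + (\<Sum>i\<in>A. e i * v i)) ^ Suc k = (x + (\<Sum>i\<in>A. e i * v i)) * (\<Sum>T\<in>Pow A. m T * G T)"
    by (simp add: Suc m_def G_def)
  also have "(x + (\<Sum>i\<in>A. e i * v i)) * s = x * s + (\<Sum>i\<in>A. v i * (e i * s))" for s
    by (simp add: distrib_left sum_distrib_left mult_ac)
  also have "(\<Sum>i\<in>A. v i * (e i * (\<Sum>T\<in>Pow A. m T * G T))) =
      (\<Sum>i\<in>A. \<Sum>T\<in>Pow A. v i * m (toggle i T) * G T)"
    by (intro sum.cong refl) (subst step, assumption, simp only: sum_distrib_left mult.assoc)
  also have "\<dots> = (\<Sum>T\<in>Pow A. (\<Sum>i\<in>A. v i * m (toggle i T)) * G T)"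
    by (subst sum.swap) (simp add: sum_distrib_right)
  also have "x * (\<Sum>T\<in>Pow A. m T * G T) + \<dots> = (\<Sum>T\<in>Pow A. fourier A x v (Suc k) T * G T)"
    by (simp only: fourier.simps m_def[symmetric] distrib_right sum.distrib sum_distrib_left mult.assoc)
  finally show ?case
    by (simp only: G_def)
qed

section \<open>Coefficients of top degree and of the trivial character\<close>

lemma card_toggle: "finite T \<Longrightarrow> card (toggle i T) = (if i \<in> T then card T - 1 else Suc (card T))"
  by (simp add: toggle_def)

text \<open>A product of \<open>k\<close> summands involves at most \<open>k\<close> distinct
  signs.\<close>

lemma fourier_eq_0: "finite T \<Longrightarrow> k < card T \<Longrightarrow> fourier A x v k T = 0"
proof (induction k arbitrary: T)
  case (Suc k)
  have "fourier A x v k (toggle i T) = 0" for i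
    using Suc.prems by (intro Suc.IH) (auto simp: card_toggle, auto simp: toggle_def)
  moreover have "fourier A x v k T = 0"
    using Suc by simp
  ultimately show ?case
    by simp
qed auto

text \<open>All \<open>k\<close> factors must supply distinct signs, and they do so in
  \<open>fact k\<close> orders.\<close>

lemma fourier_top:
  assumes "finite A" "T \<subseteq> A" "card T = k"
  shows "fourier A x v k T = fact k * (\<Prod>i\<in>T. v i)"
  using assms(2,3)
proof (induction k arbitrary: T)
  case 0
  then have "T = {}"
    using finite_subset[OF _ assms(1)] by auto
  then show ?case
    by simp
next
  case (Suc k)
  have T: "finite T"
    using Suc.prems finite_subset assms by blast
  have "(\<Sum>i\<in>A. v i * fourier A x v k (toggle i T)) = (\<Sum>i\<in>T. v i * fourier A x v k (toggle i T))"
  proof (rule sum.mono_neutral_right)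
    show "\<forall>i\<in>A - T. v i * fourier A x v k (toggle i T) = 0"
      using Suc.prems T by (auto simp: toggle_def intro!: fourier_eq_0)
  qed (use assms Suc.prems in auto)
  also have "\<dots> = (\<Sum>i\<in>T. fact k * (\<Prod>i\<in>T. v i))"
  proof (intro sum.cong refl)
    fix i assume i: "i \<in> T"
    have "fourier A x v k (toggle i T) = fact k * (\<Prod>i\<in>T - {i}. v i)"
      using i T Suc.prems Suc.IH[of "T - {i}"] by (auto simp: toggle_def)
    then show "v i * fourier A x v k (toggle i T) = fact k * (\<Prod>i\<in>T. v i)"
      using i T by (simp add: prod.remove)
  qed
  finally show ?case
    using Suc.prems T by (simp add: fourier_eq_0 algebra_simps)
qed

text \<open>Averaging over all sign patterns isolates the trivial character, and
  \<open>rademacher_sextic\<close> evaluates that average.\<close>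

lemma fourier_empty_sextic:
  fixes v :: "'a \<Rightarrow> real"
  assumes A: "finite A"
  shows "fourier A x v 6 {} = x ^ 6 + 15 * x ^ 4 * (\<Sum>i\<in>A. v i ^ 2)
      + 15 * x ^ 2 * (3 * (\<Sum>i\<in>A. v i ^ 2) ^ 2 - 2 * (\<Sum>i\<in>A. v i ^ 4))
      + 15 * (\<Sum>i\<in>A. v i ^ 2) ^ 3 - 30 * (\<Sum>i\<in>A. v i ^ 2) * (\<Sum>i\<in>A. v i ^ 4)
      + 16 * (\<Sum>i\<in>A. v i ^ 6)" (is "_ = ?R")
proof -
  have "2 ^ card A * ?R = (\<Sum>S\<in>Pow A. (x + (\<Sum>i\<in>A. sgn_of (i \<in> S) * v i)) ^ 6)"
    using rademacher_sextic[OF A] by simp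
  also have "\<dots> = (\<Sum>S\<in>Pow A. \<Sum>T\<in>Pow A. fourier A x v 6 T * (\<Prod>i\<in>T. sgn_of (i \<in> S)))"
    using A by (intro sum.cong refl power_eq_fourier) auto
  also have "\<dots> = (\<Sum>T\<in>Pow A. fourier A x v 6 T * (\<Sum>S\<in>Pow A. \<Prod>i\<in>T. sgn_of (i \<in> S)))"
    by (subst sum.swap) (simp add: sum_distrib_left)
  also have "\<dots> = (\<Sum>T\<in>Pow A. if T = {} then 2 ^ card A * fourier A x v 6 T else 0)"
    using A by (intro sum.cong refl) (auto simp: sum_Pow_sgn_of)
  also have "\<dots> = 2 ^ card A * fourier A x v 6 {}"
    using A by (simp add: sum.delta)
  finally show ?thesis
    by simp
qed

section \<open>Character sums over the code\<close>

lemma prod_sgn_of_dot: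
  assumes "length t = length g"
  shows "(\<Prod>i<length g. sgn_of (t ! i \<and> g ! i)) = sgn_of (dot t g)"
  using assms
proof (induction t g rule: list_induct2)
  case (Cons a t b g)
  then show ?case
    by (simp add: prod.lessThan_Suc_shift sgn_of_def del: prod.lessThan_Suc)
qed (simp add: sgn_of_def)

lemma character_eq_dot:
  assumes "T \<subseteq> {..<22}" "length g = 22"
  shows "(\<Prod>i\<in>T. sgn_of (g ! i)) = sgn_of (dot (word T) g)"
proof -
  have "(\<Prod>i\<in>T. sgn_of (g ! i)) = (\<Prod>i<22. sgn_of (word T ! i \<and> g ! i))"
    using assms by (intro prod.mono_neutral_cong_left) (auto simp: sgn_of_def)
  then show ?thesis
    using prod_sgn_of_dot[of "word T" g] assms by simp
qed

text \<open>Characters are multiplicative along \<open>xor_word\<close>, so the sum factors over the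
  generators. A generator meeting \<open>T\<close> oddly contributes 0.\<close>

lemma sum_list_character_coset:
  assumes "T \<subseteq> {..<22}" "length c = 22" "\<forall>g\<in>set gs. length g = 22"
  shows "(\<Sum>w\<leftarrow>coset c gs. \<Prod>i\<in>T. sgn_of (w ! i)) =
    (\<Prod>i\<in>T. sgn_of (c ! i)) * (\<Prod>g\<leftarrow>gs. 1 + (\<Prod>i\<in>T. sgn_of (g ! i)))"
  using assms(2,3)
proof (induction gs arbitrary: c)
  case (Cons g gs)
  have "(\<Prod>i\<in>T. sgn_of (xor_word c g ! i)) = (\<Prod>i\<in>T. sgn_of (c ! i) * sgn_of (g ! i))"
    using assms(1) Cons.prems by (intro prod.cong refl) (auto simp: nth_xor_word sgn_of_def)
  then show ?case
    using Cons by (simp add: prod.distrib algebra_simps)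
qed simp

definition code_words :: "bool list set" where
  "code_words = set (coset code_shift code_gens)"

definition hexad_sets :: "nat set set" where
  "hexad_sets = set ` set hexads"

lemma finite_code_words [simp]: "finite code_words"
  by (simp add: code_words_def)

lemma length_code_word: "w \<in> code_words \<Longrightarrow> length w = 22"
  unfolding code_words_def using length_coset[OF length_code_shift length_code_gens] .

lemma distinct_code: "distinct (coset code_shift code_gens)"
  by (rule distinct_coset[OF length_code_shift length_code_gens echelon_code_gens])

lemma finite_hexad_sets [simp]: "finite hexad_sets"
  by (simp add: hexad_sets_def)

lemma hexad_setsD:
  assumes "h \<in> hexad_sets"
  shows "h \<subseteq> {..<22}" "card h = 6" "finite h"
  using assms hexads_bounded by (auto simp: hexad_sets_def distinct_card)

lemma inj_word: "T \<subseteq> {..<22} \<Longrightarrow> T' \<subseteq> {..<22} \<Longrightarrow> word T = word T' \<Longrightarrow> T = T'"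
  by (metis in_mono lessThan_iff nth_word subsetI subset_antisym)

lemma weight_word:
  assumes "T \<subseteq> {..<22}"
  shows "weight (word T) = card T"
proof -
  have "weight (word T) = card (set (filter (\<lambda>i. i \<in> T) [0..<22]))"
    unfolding weight_def word_def
    by (simp only: filter_map length_map comp_def id_apply) (rule distinct_card[symmetric], simp)
  also have "set (filter (\<lambda>i. i \<in> T) [0..<22]) = T"
    using assms by auto
  finally show ?thesis .
qed

lemma distinct_hexads: "distinct hexads" "inj_on set (set hexads)"
  using distinct_word_hexads by (auto simp: distinct_map inj_on_def)

lemma card_hexad_sets: "card hexad_sets = 77"
  unfolding hexad_sets_def using distinct_hexads hexads_length by (simp add: card_image distinct_card)

text \<open>The zero word and the hexads lie on the left, and both sides have 78 elements.\<close>

lemma low_weight_dual_words: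
  "{w \<in> set (coset (word {}) dual_gens). weight w \<le> 6} = insert (word {}) (word ` hexad_sets)"
proof -
  let ?D = "{w \<in> set (coset (word {}) dual_gens). weight w \<le> 6}"
  have "distinct (coset (word {}) dual_gens)"
    by (rule distinct_coset[OF length_word length_dual_gens echelon_dual_gens])
  then have "card ?D = 78"
    using tally_dual distinct_card[of "filter (\<lambda>w. weight w \<le> 6) (coset (word {}) dual_gens)"]
    by (simp add: tally_eq set_filter)
  moreover have "card (insert (word {}) (word ` hexad_sets)) = 78"
  proof -
    have "inj_on word (insert {} hexad_sets)"
      by (intro inj_onI inj_word) (auto dest: hexad_setsD)
    moreover have "{} \<notin> hexad_sets"
      using hexad_setsD(2) by force
    ultimately show ?thesis
      using card_image[of word "insert {} hexad_sets"] card_hexad_sets by simp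
  qed
  moreover have "insert (word {}) (word ` hexad_sets) \<subseteq> ?D"
  proof -
    have "dot (word {}) g = False" if "length g = 22" for g
      using character_eq_dot[of "{}" g] that by (auto simp: sgn_of_def split: if_splits)
    then have "word {} \<in> set (coset (word {}) dual_gens)"
      using length_code_gens by (intro dual_in_coset) auto
    moreover have "word h \<in> set (coset (word {}) dual_gens)" if "h \<in> hexad_sets" for h
      using that hexads_dot by (intro dual_in_coset) (auto simp: hexad_sets_def)
    ultimately show ?thesis
      by (auto simp: weight_word hexad_setsD)
  qed
  ultimately show ?thesis
    by (intro card_subset_eq[symmetric]) auto
qed

text \<open>Unless \<open>T\<close> is in the dual code, some generator contributes the factor 0.
  Dual words of weight at most 6 are the zero word and the hexads; there the ten generators give
  1024, and the shift gives the sign.\<close>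

lemma sum_character_code:
  assumes T: "T \<subseteq> {..<22}" "card T \<le> 6"
  shows "(\<Sum>w\<in>code_words. \<Prod>i\<in>T. sgn_of (w ! i)) =
    (if T = {} then 1024 else if T \<in> hexad_sets then - 1024 else 0)"
proof -
  have sum_eq: "(\<Sum>w\<in>code_words. \<Prod>i\<in>T. sgn_of (w ! i)) =
      sgn_of (dot (word T) code_shift) * (\<Prod>g\<leftarrow>code_gens. 1 + sgn_of (dot (word T) g))"
  proof -
    have "(\<Sum>w\<in>code_words. \<Prod>i\<in>T. sgn_of (w ! i)) =
        (\<Prod>i\<in>T. sgn_of (code_shift ! i)) * (\<Prod>g\<leftarrow>code_gens. 1 + (\<Prod>i\<in>T. sgn_of (g ! i)))"
      using sum_list_character_coset[OF T(1) length_code_shift length_code_gens] distinct_code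
      by (simp add: code_words_def sum_list_distinct_conv_sum_set)
    also have "\<dots> = sgn_of (dot (word T) code_shift) * (\<Prod>g\<leftarrow>code_gens. 1 + sgn_of (dot (word T) g))"
      using length_code_gens T(1) by (simp add: character_eq_dot cong: map_cong)
    finally show ?thesis .
  qed
  show ?thesis
  proof (cases "\<forall>g\<in>set code_gens. \<not> dot (word T) g")
    case True
    have "word T \<in> set (coset (word {}) dual_gens)"
      by (rule dual_in_coset[OF True])
    then have "word T \<in> insert (word {}) (word ` hexad_sets)"
      using T by (simp add: low_weight_dual_words[symmetric] weight_word)
    then have "T = {} \<or> T \<in> hexad_sets"
      using inj_word[OF T(1)] hexad_setsD(1) by blast
    moreover have "(\<Prod>g\<leftarrow>code_gens. 1 + sgn_of (dot (word T) g)) = (\<Prod>g\<leftarrow>code_gens. 2)"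
      using True by (intro arg_cong[where f = prod_list] map_cong) (auto simp: sgn_of_def)
    then have "(\<Prod>g\<leftarrow>code_gens. 1 + sgn_of (dot (word T) g)) = 1024"
      by (simp add: code_gens_def)
    moreover have "sgn_of (dot (word T) code_shift) = - 1" if "T \<in> hexad_sets"
      using that hexads_dot by (auto simp: hexad_sets_def sgn_of_def)
    moreover have "sgn_of (dot (word T) code_shift) = 1" if "T = {}"
      using character_eq_dot[of "{}" code_shift] that by simp
    moreover have "{} \<notin> hexad_sets"
      using hexad_setsD(2) by force
    ultimately show ?thesis
      unfolding sum_eq by auto
  next
    case False
    then have "(\<Prod>g\<leftarrow>code_gens. 1 + sgn_of (dot (word T) g)) = 0"
      by (auto simp: prod_list_zero_iff sgn_of_def image_iff)
    moreover have "T \<notin> hexad_sets"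
      using False hexads_dot by (auto simp: hexad_sets_def)
    moreover have "T \<noteq> {}"
    proof
      assume "T = {}"
      then have "sgn_of (dot (word T) g) = 1" if "length g = 22" for g
        using character_eq_dot[of "{}" g] that by simp
      then show False
        using False length_code_gens by (fastforce simp: sgn_of_def)
    qed
    ultimately show ?thesis
      by (simp add: sum_eq)
  qed
qed

text \<open>Characters on more than six coordinates have coefficient 0, so only the empty set and
  the hexads survive; 720 is the factorial of 6 from \<open>fourier_top\<close>.\<close>

lemma sum_code_sextic:
  "(\<Sum>w\<in>code_words. (x + (\<Sum>i<22. sgn_of (w ! i) * v i)) ^ 6) =
    1024 * (fourier {..<22} x v 6 {} - 720 * (\<Sum>h\<in>hexad_sets. \<Prod>i\<in>h. v i))"
proof -
  let ?m = "fourier {..<22} x v 6"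
  have "(\<Sum>w\<in>code_words. (x + (\<Sum>i<22. sgn_of (w ! i) * v i)) ^ 6) =
      (\<Sum>w\<in>code_words. \<Sum>T\<in>Pow {..<22}. ?m T * (\<Prod>i\<in>T. sgn_of (w ! i)))"
    by (intro sum.cong refl power_eq_fourier) auto
  also have "\<dots> = (\<Sum>T\<in>Pow {..<22}. ?m T * (\<Sum>w\<in>code_words. \<Prod>i\<in>T. sgn_of (w ! i)))"
    by (subst sum.swap) (simp add: sum_distrib_left)
  also have "\<dots> = (\<Sum>T\<in>Pow {..<22}. ?m T * (if T = {} then 1024 else if T \<in> hexad_sets then - 1024 else 0))"
  proof (intro sum.cong refl)
    fix T :: "nat set" assume T: "T \<in> Pow {..<22}"
    show "?m T * (\<Sum>w\<in>code_words. \<Prod>i\<in>T. sgn_of (w ! i)) =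
        ?m T * (if T = {} then 1024 else if T \<in> hexad_sets then - 1024 else 0)"
    proof (cases "card T \<le> 6")
      case True
      then show ?thesis
        using T by (simp add: sum_character_code)
    next
      case False
      then show ?thesis
        using T by (simp add: fourier_eq_0 finite_subset)
    qed
  qed
  also have "\<dots> = (\<Sum>T\<in>insert {} hexad_sets. ?m T * (if T = {} then 1024 else if T \<in> hexad_sets then - 1024 else 0))"
    by (rule sum.mono_neutral_right) (auto dest: hexad_setsD)
  also have "\<dots> = 1024 * ?m {} - 1024 * (\<Sum>h\<in>hexad_sets. ?m h)"
  proof -
    have e: "{} \<notin> hexad_sets"
      using hexad_setsD(2) by force
    have "(\<Sum>h\<in>hexad_sets. ?m h * (if h = {} then 1024 else if h \<in> hexad_sets then - 1024 else 0)) =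
        (\<Sum>h\<in>hexad_sets. - (1024 * ?m h))"
    proof (intro sum.cong refl)
      fix h assume "h \<in> hexad_sets"
      then have "(if h = {} then 1024 else if h \<in> hexad_sets then - 1024 else 0) = (- 1024 :: real)"
        using e by (metis (full_types))
      then show "?m h * (if h = {} then 1024 else if h \<in> hexad_sets then - 1024 else 0) = - (1024 * ?m h)"
        by (simp only:)
    qed
    then show ?thesis
      using e by (simp only: sum.insert[OF finite_hexad_sets e] sum_negf sum_distrib_left if_True) simp
  qed
  also have "(\<Sum>h\<in>hexad_sets. ?m h) = 720 * (\<Sum>h\<in>hexad_sets. \<Prod>i\<in>h. v i)"
    unfolding sum_distrib_left
    by (intro sum.cong refl, subst fourier_top) (auto dest: hexad_setsD simp: fact_numeral)
  finally show ?thesis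
    by (simp only: right_diff_distrib)
qed

text \<open>The even sign patterns on \<open>h\<close> up to a global sign: the patterns with 0 or 2 minus signs
  represent those with 6 or 4.\<close>
lemma sum_even_signs_sextic:
  assumes h: "finite h" "card h = 6"
  shows "(\<Sum>p | p \<subseteq> h \<and> card p \<in> {0, 2}. (\<Sum>i\<in>h. sgn_of (i \<in> p) * v i) ^ 6) =
    16 * (fourier h 0 v 6 {} + 720 * (\<Prod>i\<in>h. v i))"
proof -
  let ?m = "fourier h 0 v 6"
  let ?F = "\<lambda>p. (\<Sum>i\<in>h. sgn_of (i \<in> p) * v i) ^ 6"
  let ?\<chi> = "\<lambda>T p. \<Prod>i\<in>T. sgn_of (i \<in> p)"
  let ?E = "\<lambda>K. {p. p \<subseteq> h \<and> card p \<in> K}"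
  have fin: "finite (?E K)" for K
    using h by (auto intro: finite_subset[of _ "Pow h"])
  have \<chi>h: "?\<chi> h p = (- 1) ^ card p" if "p \<subseteq> h" for p
  proof -
    have "?\<chi> h p = (\<Prod>i\<in>p. - 1)"
      using that h by (intro prod.mono_neutral_cong_right) (auto simp: sgn_of_def)
    then show ?thesis
      by simp
  qed
  \<comment> \<open>Complementing a pattern changes all signs, which a sixth power does not
    see.\<close>
  have half: "(\<Sum>p\<in>?E {4, 6}. ?F p) = (\<Sum>p\<in>?E {0, 2}. ?F p)"
  proof (rule sum.reindex_bij_witness[where i = "\<lambda>p. h - p" and j = "\<lambda>p. h - p"])
    fix p assume "p \<in> ?E {4, 6}"
    then have "(\<Sum>i\<in>h. sgn_of (i \<in> h - p) * v i) = (\<Sum>i\<in>h. - (sgn_of (i \<in> p) * v i))"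
      by (intro sum.cong) (auto simp: sgn_of_def)
    then show "?F (h - p) = ?F p"
      by (simp add: sum_negf)
  qed (use h card_subset_eq[OF h(1)] in \<open>auto simp: card_Diff_subset finite_subset double_diff\<close>)
  \<comment> \<open>The factor \<open>(1 + ?\<chi> h p) / 2\<close> selects the even patterns. As
    \<open>?\<chi> h\<close> takes the character of \<open>T\<close> to that of
    \<open>h - T\<close>, only \<open>{}\<close> and \<open>h\<close> survive, each with 64 /
    2.\<close>
  have "32 * ?m {} + 32 * ?m h = (\<Sum>T\<in>Pow h. ?m T * (if T = {} then 32 else if T = h then 32 else 0))"
  proof -
    have "(\<Sum>T\<in>Pow h. ?m T * (if T = {} then 32 else if T = h then 32 else 0)) =
        (\<Sum>T\<in>{{}, h}. ?m T * (if T = {} then 32 else if T = h then 32 else 0))"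
      using h by (intro sum.mono_neutral_right) auto
    moreover have "h \<noteq> {}"
      using h by auto
    ultimately show ?thesis
      by simp
  qed
  also have "\<dots> = (\<Sum>T\<in>Pow h. ?m T * ((\<Sum>p\<in>Pow h. ?\<chi> T p) + (\<Sum>p\<in>Pow h. ?\<chi> (h - T) p)) / 2)"
  proof (intro sum.cong refl)
    fix T assume "T \<in> Pow h"
    moreover have "h \<noteq> {}"
      using h by auto
    ultimately show "?m T * (if T = {} then 32 else if T = h then 32 else 0) =
        ?m T * ((\<Sum>p\<in>Pow h. ?\<chi> T p) + (\<Sum>p\<in>Pow h. ?\<chi> (h - T) p)) / 2"
      using h by (subst (1 2) sum_Pow_sgn_of) auto
  qed
  also have "\<dots> = (\<Sum>T\<in>Pow h. \<Sum>p\<in>Pow h. ?m T * ?\<chi> T p * ((1 + (- 1) ^ card p) / 2))"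
  proof (intro sum.cong refl)
    fix T assume T: "T \<in> Pow h"
    have "?\<chi> (h - T) p = ?\<chi> T p * (- 1) ^ card p" if "p \<in> Pow h" for p
    proof -
      have "?\<chi> h p = ?\<chi> (h - T) p * ?\<chi> T p"
        using T h by (simp add: prod.subset_diff)
      moreover have "?\<chi> T p * ?\<chi> T p = 1"
        by (simp add: prod.distrib[symmetric])
      moreover have "?\<chi> h p = (- 1) ^ card p"
        using \<chi>h that by simp
      ultimately show ?thesis
        by (metis mult.assoc mult.commute mult.right_neutral)
    qed
    then have "(\<Sum>p\<in>Pow h. ?\<chi> (h - T) p) = (\<Sum>p\<in>Pow h. ?\<chi> T p * (- 1) ^ card p)"
      by (intro sum.cong refl)
    then show "?m T * ((\<Sum>p\<in>Pow h. ?\<chi> T p) + (\<Sum>p\<in>Pow h. ?\<chi> (h - T) p)) / 2 =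
        (\<Sum>p\<in>Pow h. ?m T * ?\<chi> T p * ((1 + (- 1) ^ card p) / 2))"
      by (simp add: sum.distrib[symmetric] sum_distrib_left sum_divide_distrib algebra_simps)
  qed
  also have "\<dots> = (\<Sum>p\<in>Pow h. ?F p * ((1 + (- 1) ^ card p) / 2))"
  proof (subst sum.swap, intro sum.cong refl)
    fix p
    have "?F p = (0 + (\<Sum>i\<in>h. sgn_of (i \<in> p) * v i)) ^ 6"
      by simp
    also have "\<dots> = (\<Sum>T\<in>Pow h. ?m T * ?\<chi> T p)"
      using h by (intro power_eq_fourier) auto
    finally show "(\<Sum>T\<in>Pow h. ?m T * ?\<chi> T p * ((1 + (- 1) ^ card p) / 2)) = ?F p * ((1 + (- 1) ^ card p) / 2)"
      by (simp add: sum_distrib_right)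
  qed
  also have "\<dots> = (\<Sum>p\<in>?E {0, 2} \<union> ?E {4, 6}. ?F p)"
  proof (rule sum.mono_neutral_cong_right)
    show "\<forall>p\<in>Pow h - (?E {0, 2} \<union> ?E {4, 6}). ?F p * ((1 + (- 1) ^ card p) / 2) = 0"
    proof
      fix p assume p: "p \<in> Pow h - (?E {0, 2} \<union> ?E {4, 6})"
      then have "card p \<le> 6"
        using h card_mono[of h p] by auto
      moreover have "card p \<notin> {0, 2, 4, 6}"
        using p by auto
      ultimately have "card p \<in> {1, 3, 5}"
        by auto
      then show "?F p * ((1 + (- 1) ^ card p) / 2) = 0"
        by auto
    qed
  qed (use h in auto)
  also have "\<dots> = (\<Sum>p\<in>?E {0, 2}. ?F p) + (\<Sum>p\<in>?E {4, 6}. ?F p)"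
    by (intro sum.union_disjoint fin) auto
  finally have "32 * ?m {} + 32 * ?m h = 2 * (\<Sum>p\<in>?E {0, 2}. ?F p)"
    using half by simp
  moreover have "?m h = 720 * (\<Prod>i\<in>h. v i)"
    using h by (subst fourier_top) (auto simp: fact_numeral)
  ultimately show ?thesis
    by simp
qed

section \<open>Incidence counts and moment sums over hexads\<close>

lemma card_hexads_filter: "card {h \<in> hexad_sets. P h} = length (filter (\<lambda>h. P (set h)) hexads)"
proof -
  have "{h \<in> hexad_sets. P h} = set ` set (filter (\<lambda>h. P (set h)) hexads)"
    by (auto simp: hexad_sets_def)
  moreover have "inj_on set (set (filter (\<lambda>h. P (set h)) hexads))"
    using distinct_hexads(2) by (rule inj_on_subset) auto
  ultimately show ?thesis
    by (simp only: card_image distinct_card[OF distinct_filter[OF distinct_hexads(1)]])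
qed

lemma card_hexads_through_point: "i < 22 \<Longrightarrow> card {h \<in> hexad_sets. {i} \<subseteq> h} = 21"
  using hexads_points_ok unfolding card_hexads_filter by (simp add: points_ok_def through_def)

lemma card_hexads_through_pair:
  assumes "i < 22" "j < 22" "i \<noteq> j"
  shows "card {h \<in> hexad_sets. {i, j} \<subseteq> h} = 5"
proof -
  have *: "card {h \<in> hexad_sets. {i, j} \<subseteq> h} = 5" if "i < j" "j < 22" for i j
  proof -
    have "length (through j (through i hexads)) = 5"
      using hexads_points_ok that by (simp add: points_ok_def pairs_ok_def)
    then show ?thesis
      unfolding card_hexads_filter by (simp add: through_def conj_commute)
  qed
  show ?thesis
    using *[of i j] *[of j i] assms by (cases "i < j") (auto simp: insert_commute)
qed

lemma card_hexads_through_triple: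
  assumes "i < 22" "j < 22" "k < 22" "i \<noteq> j" "j \<noteq> k" "i \<noteq> k"
  shows "card {h \<in> hexad_sets. {i, j, k} \<subseteq> h} = 1"
proof -
  have *: "card {h \<in> hexad_sets. {i, j, k} \<subseteq> h} = 1" if "i < j" "j < k" "k < 22" for i j k
  proof -
    have "length (through k (through j (through i hexads))) = 1"
      using hexads_points_ok that by (simp add: points_ok_def pairs_ok_def)
    then show ?thesis
      unfolding card_hexads_filter by (simp add: through_def conj_ac)
  qed
  have "i < j \<and> j < k \<or> i < k \<and> k < j \<or> j < i \<and> i < k \<or> j < k \<and> k < i \<or> k < i \<and> i < j \<or> k < j \<and> j < i"
    using assms by linarith
  then show ?thesis
    using *[of i j k] *[of i k j] *[of j i k] *[of j k i] *[of k i j] *[of k j i] assms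
    by (elim disjE) (simp_all only: insert_commute)
qed

text \<open>One formula for all coincidences: 1, then 1 + 4 = 5, then 1 + 12 + 8 = 21.\<close>

lemma card_hexads_through:
  assumes "i < 22" "j < 22" "k < 22"
  shows "real (card {h \<in> hexad_sets. {i, j, k} \<subseteq> h}) =
    1 + 4 * of_bool (i = j) + 4 * of_bool (j = k) + 4 * of_bool (i = k) + 8 * of_bool (i = j \<and> j = k)"
  using card_hexads_through_point[of i] card_hexads_through_pair[of i k] card_hexads_through_pair[of i j]
    card_hexads_through_triple[of i j k] assms
  by (cases "i = j"; cases "j = k"; cases "i = k") (simp_all add: conj_ac)

text \<open>Exchanging the sums counts the hexads through \<open>{i, j, l}\<close>; each indicator
  in \<open>card_hexads_through\<close> contracts some of the three indices.\<close>

lemma sum_hexads_triple: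
  fixes a b c :: "nat \<Rightarrow> real"
  shows "(\<Sum>h\<in>hexad_sets. (\<Sum>i\<in>h. a i) * (\<Sum>i\<in>h. b i) * (\<Sum>i\<in>h. c i)) =
    (\<Sum>i<22. a i) * (\<Sum>i<22. b i) * (\<Sum>i<22. c i)
    + 4 * (\<Sum>i<22. a i * b i) * (\<Sum>i<22. c i) + 4 * (\<Sum>i<22. a i) * (\<Sum>i<22. b i * c i)
    + 4 * (\<Sum>i<22. a i * c i) * (\<Sum>i<22. b i) + 8 * (\<Sum>i<22. a i * b i * c i)"
proof -
  have restrict: "(\<Sum>i\<in>h. f i) = (\<Sum>i<22. of_bool (i \<in> h) * f i)" if "h \<in> hexad_sets" for h and f :: "nat \<Rightarrow> real"
    using hexad_setsD(1)[OF that] by (intro sum.mono_neutral_cong_left) auto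
  have triple: "(\<Sum>i<22. f i) * (\<Sum>i<22. g i) * (\<Sum>i<22. k i) = (\<Sum>i<22. \<Sum>j<22. \<Sum>l<22. f i * g j * k l)"
    for f g k :: "nat \<Rightarrow> real"
  proof -
    have "(\<Sum>i<22. f i) * (\<Sum>i<22. g i) * (\<Sum>i<22. k i) = (\<Sum>i<22. (\<Sum>j<22. f i * g j) * (\<Sum>i<22. k i))"
      unfolding sum_product[of f] by (rule sum_distrib_right)
    then show ?thesis
      by (simp only: sum_product)
  qed
  have "(\<Sum>h\<in>hexad_sets. (\<Sum>i\<in>h. a i) * (\<Sum>i\<in>h. b i) * (\<Sum>i\<in>h. c i)) =
      (\<Sum>h\<in>hexad_sets. \<Sum>i<22. \<Sum>j<22. \<Sum>l<22. a i * b j * c l * of_bool ({i, j, l} \<subseteq> h))"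
  proof (intro sum.cong refl)
    fix h assume h: "h \<in> hexad_sets"
    show "(\<Sum>i\<in>h. a i) * (\<Sum>i\<in>h. b i) * (\<Sum>i\<in>h. c i) =
        (\<Sum>i<22. \<Sum>j<22. \<Sum>l<22. a i * b j * c l * of_bool ({i, j, l} \<subseteq> h))"
      unfolding restrict[OF h] triple by (intro sum.cong refl) auto
  qed
  also have "\<dots> = (\<Sum>i<22. \<Sum>h\<in>hexad_sets. \<Sum>j<22. \<Sum>l<22. a i * b j * c l * of_bool ({i, j, l} \<subseteq> h))"
    by (rule sum.swap)
  also have "\<dots> = (\<Sum>i<22. \<Sum>j<22. \<Sum>h\<in>hexad_sets. \<Sum>l<22. a i * b j * c l * of_bool ({i, j, l} \<subseteq> h))"
    by (intro sum.cong refl sum.swap)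
  also have "\<dots> = (\<Sum>i<22. \<Sum>j<22. \<Sum>l<22. \<Sum>h\<in>hexad_sets. a i * b j * c l * of_bool ({i, j, l} \<subseteq> h))"
    by (intro sum.cong refl sum.swap)
  also have "\<dots> = (\<Sum>i<22. \<Sum>j<22. \<Sum>l<22. a i * b j * c l *
      (1 + 4 * of_bool (i = j) + 4 * of_bool (j = l) + 4 * of_bool (i = l) + 8 * of_bool (i = j \<and> j = l)))"
  proof (intro sum.cong refl)
    fix i j l :: nat assume ijl: "i \<in> {..<22}" "j \<in> {..<22}" "l \<in> {..<22}"
    have "(\<Sum>h\<in>hexad_sets. a i * b j * c l * of_bool ({i, j, l} \<subseteq> h)) =
        a i * b j * c l * (\<Sum>h\<in>hexad_sets. of_bool ({i, j, l} \<subseteq> h))"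
      by (rule sum_distrib_left[symmetric])
    also have "(\<Sum>h\<in>hexad_sets. of_bool ({i, j, l} \<subseteq> h)) = real (card {h \<in> hexad_sets. {i, j, l} \<subseteq> h})"
      by (simp add: sum.If_cases of_bool_def Int_def)
    also have "\<dots> = 1 + 4 * of_bool (i = j) + 4 * of_bool (j = l) + 4 * of_bool (i = l) + 8 * of_bool (i = j \<and> j = l)"
      using ijl by (intro card_hexads_through) auto
    finally show "(\<Sum>h\<in>hexad_sets. a i * b j * c l * of_bool ({i, j, l} \<subseteq> h)) = a i * b j * c l *
        (1 + 4 * of_bool (i = j) + 4 * of_bool (j = l) + 4 * of_bool (i = l) + 8 * of_bool (i = j \<and> j = l))" .
  qed
  also have "\<dots> = (\<Sum>i<22. \<Sum>j<22. \<Sum>l<22. a i * b j * c l)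
      + 4 * (\<Sum>i<22. \<Sum>j<22. \<Sum>l<22. a i * b j * c l * of_bool (i = j))
      + 4 * (\<Sum>i<22. \<Sum>j<22. \<Sum>l<22. a i * b j * c l * of_bool (j = l))
      + 4 * (\<Sum>i<22. \<Sum>j<22. \<Sum>l<22. a i * b j * c l * of_bool (i = l))
      + 8 * (\<Sum>i<22. \<Sum>j<22. \<Sum>l<22. a i * b j * c l * of_bool (i = j \<and> j = l))"
    unfolding sum_distrib_left sum.distrib[symmetric] by (intro sum.cong refl) (simp add: algebra_simps)
  also have "(\<Sum>i<22. \<Sum>j<22. \<Sum>l<22. a i * b j * c l) = (\<Sum>i<22. a i) * (\<Sum>i<22. b i) * (\<Sum>i<22. c i)"
    by (simp only: triple)
  also have "(\<Sum>i<22. \<Sum>j<22. \<Sum>l<22. a i * b j * c l * of_bool (i = j)) = (\<Sum>i<22. a i * b i) * (\<Sum>i<22. c i)"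
  proof -
    have "(\<Sum>j<22. \<Sum>l<22. a i * b j * c l * of_bool (i = j)) = a i * b i * (\<Sum>l<22. c l)" if "i \<in> {..<22}" for i
    proof -
      have "(\<Sum>j<22. \<Sum>l<22. a i * b j * c l * of_bool (i = j)) = (\<Sum>j<22. if i = j then a i * b j * (\<Sum>l<22. c l) else 0)"
        by (intro sum.cong refl) (simp add: sum_distrib_left)
      then show ?thesis
        using that by (simp only: sum.delta'[OF finite_lessThan] if_True)
    qed
    then show ?thesis
      by (simp only: sum_distrib_right cong: sum.cong)
  qed
  also have "(\<Sum>i<22. \<Sum>j<22. \<Sum>l<22. a i * b j * c l * of_bool (j = l)) = (\<Sum>i<22. a i) * (\<Sum>i<22. b i * c i)"
  proof -
    have "(\<Sum>l<22. a i * b j * c l * of_bool (j = l)) = a i * (b j * c j)" if "j \<in> {..<22}" for i j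
    proof -
      have "(\<Sum>l<22. a i * b j * c l * of_bool (j = l)) = (\<Sum>l<22. if j = l then a i * (b j * c l) else 0)"
        by (intro sum.cong refl) simp
      then show ?thesis
        using that by (simp only: sum.delta'[OF finite_lessThan] if_True)
    qed
    then show ?thesis
      by (simp only: sum_product cong: sum.cong)
  qed
  also have "(\<Sum>i<22. \<Sum>j<22. \<Sum>l<22. a i * b j * c l * of_bool (i = l)) = (\<Sum>i<22. a i * c i) * (\<Sum>i<22. b i)"
  proof -
    have "(\<Sum>l<22. a i * b j * c l * of_bool (i = l)) = a i * c i * b j" if "i \<in> {..<22}" for i j
    proof -
      have "(\<Sum>l<22. a i * b j * c l * of_bool (i = l)) = (\<Sum>l<22. if i = l then a i * c l * b j else 0)"
        by (intro sum.cong refl) simp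
      then show ?thesis
        using that by (simp only: sum.delta'[OF finite_lessThan] if_True)
    qed
    then show ?thesis
      by (simp only: sum_product cong: sum.cong)
  qed
  also have "(\<Sum>i<22. \<Sum>j<22. \<Sum>l<22. a i * b j * c l * of_bool (i = j \<and> j = l)) = (\<Sum>i<22. a i * b i * c i)"
  proof (intro sum.cong refl)
    fix i :: nat assume i: "i \<in> {..<22}"
    have "(\<Sum>j<22. \<Sum>l<22. a i * b j * c l * of_bool (i = j \<and> j = l)) =
        (\<Sum>j<22. if i = j then (\<Sum>l<22. if i = l then a i * b i * c l else 0) else 0)"
    proof (intro sum.cong refl)
      fix j
      show "(\<Sum>l<22. a i * b j * c l * of_bool (i = j \<and> j = l)) =
          (if i = j then (\<Sum>l<22. if i = l then a i * b i * c l else 0) else 0)"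
        by (cases "i = j") (auto intro!: sum.cong)
    qed
    then show "(\<Sum>j<22. \<Sum>l<22. a i * b j * c l * of_bool (i = j \<and> j = l)) = a i * b i * c i"
      using i by (simp only: sum.delta'[OF finite_lessThan] if_True)
  qed
  finally show ?thesis
    by (simp only: mult.assoc)
qed

text \<open>The sums over pairs and points follow from triples by inserting the constant function 1,
  because every hexad has six elements.\<close>
lemma sum_hexads_pair:
  fixes a b :: "nat \<Rightarrow> real"
  shows "(\<Sum>h\<in>hexad_sets. (\<Sum>i\<in>h. a i) * (\<Sum>i\<in>h. b i)) =
    5 * (\<Sum>i<22. a i) * (\<Sum>i<22. b i) + 16 * (\<Sum>i<22. a i * b i)"
proof -
  have "(\<Sum>h\<in>hexad_sets. (\<Sum>i\<in>h. a i) * (\<Sum>i\<in>h. b i) * (\<Sum>i\<in>h. 1)) =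
      (\<Sum>h\<in>hexad_sets. (\<Sum>i\<in>h. a i) * (\<Sum>i\<in>h. b i)) * 6"
    unfolding sum_distrib_right using hexad_setsD(2) by (intro sum.cong refl) simp
  then show ?thesis
    using sum_hexads_triple[of a b "\<lambda>_. 1"] by simp
qed

lemma sum_hexads_point:
  fixes a :: "nat \<Rightarrow> real"
  shows "(\<Sum>h\<in>hexad_sets. \<Sum>i\<in>h. a i) = 21 * (\<Sum>i<22. a i)"
proof -
  have "(\<Sum>h\<in>hexad_sets. (\<Sum>i\<in>h. a i) * (\<Sum>i\<in>h. 1)) = (\<Sum>h\<in>hexad_sets. \<Sum>i\<in>h. a i) * 6"
    unfolding sum_distrib_right using hexad_setsD(2) by (intro sum.cong refl) (simp add: sum_distrib_right)
  then show ?thesis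
    using sum_hexads_pair[of a "\<lambda>_. 1"] by simp
qed

text \<open>The 2300 lines, all of squared norm 24, are paired with a linear form
  \<open>(d, v)\<close>, whose dual squared norm is the base on the right. The products over hexads
  cancel between the hexad lines and the code lines because 64 * 16 = 1024.\<close>

lemma sum_lines_sextic:
  fixes v :: "nat \<Rightarrow> real"
  shows "(\<Sum>i<22. (4 * d + 4 * v i) ^ 6 + (4 * d - 4 * v i) ^ 6)
    + 64 * (\<Sum>h\<in>hexad_sets. \<Sum>p | p \<subseteq> h \<and> card p \<in> {0, 2}. (\<Sum>i\<in>h. sgn_of (i \<in> p) * v i) ^ 6)
    + (\<Sum>w\<in>code_words. (2 * d + (\<Sum>i<22. sgn_of (w ! i) * v i)) ^ 6)
    = 30720 * (2 * d ^ 2 + (\<Sum>i<22. v i ^ 2)) ^ 3"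
proof -
  define p2 where "p2 = (\<Sum>i<22. v i ^ 2)"
  define p4 where "p4 = (\<Sum>i<22. v i ^ 4)"
  define p6 where "p6 = (\<Sum>i<22. v i ^ 6)"
  define e where "e = (\<Sum>h\<in>hexad_sets. \<Prod>i\<in>h. v i)"
  have A: "(\<Sum>i<22. (4 * d + 4 * v i) ^ 6 + (4 * d - 4 * v i) ^ 6) =
      8192 * (22 * d ^ 6 + 15 * d ^ 4 * p2 + 15 * d ^ 2 * p4 + p6)"
  proof -
    have "(4 * d + 4 * y) ^ 6 + (4 * d - 4 * y) ^ 6 =
        8192 * d ^ 6 + 122880 * d ^ 4 * y ^ 2 + 122880 * d ^ 2 * y ^ 4 + 8192 * y ^ 6" for y
      by algebra
    then show ?thesis
      by (simp add: sum.distrib sum_distrib_left[symmetric] p2_def p4_def p6_def)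
  qed
  have B: "(\<Sum>h\<in>hexad_sets. \<Sum>p | p \<subseteq> h \<and> card p \<in> {0, 2}. (\<Sum>i\<in>h. sgn_of (i \<in> p) * v i) ^ 6) =
      16 * (15 * (p2 ^ 3 + 12 * p2 * p4 + 8 * p6) - 30 * (5 * p2 * p4 + 16 * p6) + 336 * p6 + 720 * e)"
  proof -
    have "(\<Sum>h\<in>hexad_sets. \<Sum>p | p \<subseteq> h \<and> card p \<in> {0, 2}. (\<Sum>i\<in>h. sgn_of (i \<in> p) * v i) ^ 6) =
        (\<Sum>h\<in>hexad_sets. 16 * (15 * ((\<Sum>i\<in>h. v i ^ 2) * (\<Sum>i\<in>h. v i ^ 2) * (\<Sum>i\<in>h. v i ^ 2))
          - 30 * ((\<Sum>i\<in>h. v i ^ 2) * (\<Sum>i\<in>h. v i ^ 4)) + 16 * (\<Sum>i\<in>h. v i ^ 6)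
          + 720 * (\<Prod>i\<in>h. v i)))"
    proof (intro sum.cong refl)
      fix h assume h: "h \<in> hexad_sets"
      show "(\<Sum>p | p \<subseteq> h \<and> card p \<in> {0, 2}. (\<Sum>i\<in>h. sgn_of (i \<in> p) * v i) ^ 6) =
          16 * (15 * ((\<Sum>i\<in>h. v i ^ 2) * (\<Sum>i\<in>h. v i ^ 2) * (\<Sum>i\<in>h. v i ^ 2))
          - 30 * ((\<Sum>i\<in>h. v i ^ 2) * (\<Sum>i\<in>h. v i ^ 4)) + 16 * (\<Sum>i\<in>h. v i ^ 6)
          + 720 * (\<Prod>i\<in>h. v i))"
        unfolding sum_even_signs_sextic[OF hexad_setsD(3,2)[OF h]] fourier_empty_sextic[OF hexad_setsD(3)[OF h]]
        by (simp add: power3_eq_cube)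
    qed
    also have "\<dots> = 16 * (15 * (\<Sum>h\<in>hexad_sets. (\<Sum>i\<in>h. v i ^ 2) * (\<Sum>i\<in>h. v i ^ 2) * (\<Sum>i\<in>h. v i ^ 2))
        - 30 * (\<Sum>h\<in>hexad_sets. (\<Sum>i\<in>h. v i ^ 2) * (\<Sum>i\<in>h. v i ^ 4))
        + 16 * (\<Sum>h\<in>hexad_sets. \<Sum>i\<in>h. v i ^ 6) + 720 * e)"
      by (simp only: sum_distrib_left[symmetric] sum.distrib sum_subtractf e_def)
    also have "\<dots> = 16 * (15 * (p2 * p2 * p2 + 4 * p4 * p2 + 4 * p2 * p4 + 4 * p4 * p2 + 8 * p6)
        - 30 * (5 * p2 * p4 + 16 * p6) + 16 * (21 * p6) + 720 * e)"
      unfolding sum_hexads_triple sum_hexads_pair sum_hexads_point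
      by (simp only: power_add[symmetric] p2_def p4_def p6_def) simp
    finally show ?thesis
      by (simp add: algebra_simps power3_eq_cube)
  qed
  have C: "(\<Sum>w\<in>code_words. (2 * d + (\<Sum>i<22. sgn_of (w ! i) * v i)) ^ 6) =
      1024 * ((2 * d) ^ 6 + 15 * (2 * d) ^ 4 * p2 + 15 * (2 * d) ^ 2 * (3 * p2 ^ 2 - 2 * p4)
        + 15 * p2 ^ 3 - 30 * p2 * p4 + 16 * p6 - 720 * e)"
    unfolding sum_code_sextic fourier_empty_sextic[OF finite_lessThan] p2_def p4_def p6_def e_def ..
  show ?thesis
    unfolding A B C p2_def[symmetric] by algebra
qed

section \<open>The point set\<close>

lemma card_code_weight:
  "card {w \<in> code_words. weight w = 7} = 176"
  "card {w \<in> code_words. weight w = 11} = 672"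
  "card {w \<in> code_words. weight w = 15} = 176"
proof -
  have "card {w \<in> code_words. weight w = k} = tally (\<lambda>w. weight w = k) code_shift code_gens" for k
    using distinct_card[OF distinct_filter[OF distinct_code], of "\<lambda>w. weight w = k"]
    by (simp add: tally_eq code_words_def)
  then show "card {w \<in> code_words. weight w = 7} = 176"
    "card {w \<in> code_words. weight w = 11} = 672" "card {w \<in> code_words. weight w = 15} = 176"
    by (simp_all add: tally_code)
qed

lemma card_code_words: "card code_words = 1024"
proof -
  have "length (coset c gs) = 2 ^ length gs" for c gs
    by (induction gs arbitrary: c) auto
  then show ?thesis
    using distinct_card[OF distinct_code] by (simp add: code_words_def code_gens_def)
qed

text \<open>176 + 672 + 176 = 1024, so no other weight occurs.\<close>

lemma sum_code_by_weight:
  "(\<Sum>w\<in>code_words. f w) = (\<Sum>w | w \<in> code_words \<and> weight w = 7. f w)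
    + (\<Sum>w | w \<in> code_words \<and> weight w = 11. f w) + (\<Sum>w | w \<in> code_words \<and> weight w = 15. f w)"
proof -
  let ?W = "\<lambda>k. {w \<in> code_words. weight w = k}"
  have "card (?W 7 \<union> ?W 11 \<union> ?W 15) = 1024"
    using card_code_weight by (subst card_Un_disjoint; (subst card_Un_disjoint)?) auto
  then have "?W 7 \<union> ?W 11 \<union> ?W 15 = code_words"
    using card_code_words by (intro card_subset_eq) auto
  moreover have "(\<Sum>w\<in>?W 7 \<union> ?W 11 \<union> ?W 15. f w) = (\<Sum>w\<in>?W 7. f w) + (\<Sum>w\<in>?W 11. f w) + (\<Sum>w\<in>?W 15. f w)"
    by (subst sum.union_disjoint; (subst sum.union_disjoint)?) auto
  ultimately show ?thesis
    by simp
qed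

lemma sum_sgn_of_word:
  assumes "length w = 22"
  shows "(\<Sum>n<22. sgn_of (w ! n)) = 22 - 2 * real (weight w)"
proof -
  have "(\<Sum>n<length w. sgn_of (w ! n)) = real (length w) - 2 * real (weight w)"
    by (induction w) (simp_all add: sum.lessThan_Suc_shift weight_def sgn_of_def del: sum.lessThan_Suc)
  then show ?thesis
    using assms by simp
qed

lemma sum_sgn_of_subset:
  assumes "finite h" "p \<subseteq> h"
  shows "(\<Sum>n\<in>h. sgn_of (n \<in> p)) = real (card h) - 2 * real (card p)"
proof -
  have "(\<Sum>n\<in>h. sgn_of (n \<in> p)) = (\<Sum>n\<in>h. 1 - 2 * of_bool (n \<in> p))"
    by (intro sum.cong) (auto simp: sgn_of_def)
  also have "\<dots> = real (card h) - 2 * (\<Sum>n\<in>h. of_bool (n \<in> p))"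
    by (simp add: sum_subtractf sum_distrib_left)
  also have "(\<Sum>n\<in>h. of_bool (n \<in> p)) = real (card p)"
    using assms by (simp add: sum.If_cases of_bool_def Int_absorb1)
  finally show ?thesis .
qed

text \<open>A line spanned by \<open>(d, z)\<close> is scaled so that its height \<open>2 * d - (\<Sum>n<22. z n)\<close> becomes 1, and
  only the part \<open>z\<close> is kept. The heights \<open>\<plusminus> 12\<close> give the inner and \<open>\<plusminus> 4\<close> the outer points; the
  lines are \<open>(4, \<plusminus> 4 * e\<^sub>i)\<close>, \<open>(0, 2 * \<epsilon>)\<close> with \<open>\<epsilon>\<close> an even sign pattern on a hexad, and
  \<open>(2, \<epsilon>)\<close> with \<open>\<epsilon>\<close> the signs of a code word.\<close>
definition coord_pt :: "real \<Rightarrow> nat \<Rightarrow> nat \<Rightarrow> real" where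
  "coord_pt a i n = (if n = i then a else 0)"

definition hexad_pt :: "real \<Rightarrow> nat set \<Rightarrow> nat set \<Rightarrow> nat \<Rightarrow> real" where
  "hexad_pt a h p n = (if n \<in> h then a * sgn_of (n \<in> p) else 0)"

definition code_pt :: "real \<Rightarrow> bool list \<Rightarrow> nat \<Rightarrow> real" where
  "code_pt a w n = (if n < 22 then a * sgn_of (w ! n) else 0)"

text \<open>The lines of height 12, -12 and 12 in turn, numbering 22 + 77 + 176:
  \<open>(4, -4 * e_i)\<close> divided by 12, the all-plus hexad patterns divided by -12, and the
  words of weight 15 divided by 12.\<close>

definition inner_pts :: "(nat \<Rightarrow> real) set" where
  "inner_pts = coord_pt (- 1 / 3) ` {..<22} \<union> (\<lambda>h. hexad_pt (- 1 / 6) h {}) ` hexad_sets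
    \<union> code_pt (1 / 12) ` {w \<in> code_words. weight w = 15}"

text \<open>Here the heights are 4, -4, 4 and -4, with 22 + 77 * 15 + 672 + 176 lines.\<close>

definition outer_pts :: "(nat \<Rightarrow> real) set" where
  "outer_pts = coord_pt 1 ` {..<22}
    \<union> (\<lambda>(h, p). hexad_pt (- 1 / 2) h p) ` (SIGMA h:hexad_sets. {p. p \<subseteq> h \<and> card p = 2})
    \<union> (code_pt (1 / 4) ` {w \<in> code_words. weight w = 11} \<union> code_pt (- 1 / 4) ` {w \<in> code_words. weight w = 7})"

text \<open>Supports of size 1, 6 and 22 tell the three kinds of points apart.\<close>

lemma support_coord_pt: "a \<noteq> 0 \<Longrightarrow> {n. coord_pt a i n \<noteq> 0} = {i}"
  by (auto simp: coord_pt_def)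

lemma support_hexad_pt: "a \<noteq> 0 \<Longrightarrow> {n. hexad_pt a h p n \<noteq> 0} = h"
  by (auto simp: hexad_pt_def sgn_of_def)

lemma support_code_pt: "a \<noteq> 0 \<Longrightarrow> {n. code_pt a w n \<noteq> 0} = {..<22}"
  by (auto simp: code_pt_def sgn_of_def)

lemma coord_ne_hexad_pt: "a \<noteq> 0 \<Longrightarrow> b \<noteq> 0 \<Longrightarrow> h \<in> hexad_sets \<Longrightarrow> coord_pt a i \<noteq> hexad_pt b h p"
  using support_coord_pt[of a i] support_hexad_pt[of b h p] hexad_setsD(2)[of h] by auto

lemma coord_ne_code_pt: "a \<noteq> 0 \<Longrightarrow> b \<noteq> 0 \<Longrightarrow> coord_pt a i \<noteq> code_pt b w"
proof
  assume "a \<noteq> 0" "b \<noteq> 0" "coord_pt a i = code_pt b w"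
  then have "card {i} = card {..<22::nat}"
    using support_coord_pt[of a i] support_code_pt[of b w] by simp
  then show False
    by simp
qed

lemma hexad_ne_code_pt: "a \<noteq> 0 \<Longrightarrow> b \<noteq> 0 \<Longrightarrow> h \<in> hexad_sets \<Longrightarrow> hexad_pt a h p \<noteq> code_pt b w"
proof
  assume "a \<noteq> 0" "b \<noteq> 0" "h \<in> hexad_sets" "hexad_pt a h p = code_pt b w"
  then have "card h = card {..<22::nat}"
    using support_hexad_pt[of a h p] support_code_pt[of b w] by simp
  with \<open>h \<in> hexad_sets\<close> show False
    by (simp add: hexad_setsD)
qed

lemma inj_coord_pt: "a \<noteq> 0 \<Longrightarrow> inj_on (coord_pt a) A"
  using support_coord_pt[of a] by (metis inj_onI singleton_inject)

lemma hexad_pt_eqD: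
  assumes "a \<noteq> 0" "p \<subseteq> h" "p' \<subseteq> h'" "hexad_pt a h p = hexad_pt a h' p'"
  shows "h = h' \<and> p = p'"
proof -
  have h: "h = h'"
    using support_hexad_pt[OF assms(1)] assms(4) by metis
  have "n \<in> p \<longleftrightarrow> n \<in> p'" if "n \<in> h" for n
    using fun_cong[OF assms(4), of n] that h assms(1) by (auto simp: hexad_pt_def sgn_of_def split: if_splits)
  then show ?thesis
    using h assms(2,3) by auto
qed

lemma inj_code_pt: "a \<noteq> 0 \<Longrightarrow> inj_on (code_pt a) {w \<in> code_words. P w}"
proof (rule inj_onI)
  fix w w' assume a: "a \<noteq> 0" and w: "w \<in> {w \<in> code_words. P w}" "w' \<in> {w \<in> code_words. P w}"
    and eq: "code_pt a w = code_pt a w'"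
  show "w = w'"
  proof (rule nth_equalityI)
    show "length w = length w'"
      using w by (simp add: length_code_word)
    fix n assume "n < length w"
    then have "n < 22"
      using w by (simp add: length_code_word)
    then show "w ! n = w' ! n"
      using fun_cong[OF eq, of n] a by (auto simp: code_pt_def sgn_of_def split: if_splits)
  qed
qed

lemma sum_coord_pt: "i < 22 \<Longrightarrow> (\<Sum>n<22. coord_pt a i n * v n) = a * v i"
proof -
  assume i: "i < 22"
  have "(\<Sum>n<22. coord_pt a i n * v n) = (\<Sum>n<22. if n = i then a * v n else 0)"
    by (intro sum.cong) (auto simp: coord_pt_def)
  then show ?thesis
    using i by (simp only: sum.delta[OF finite_lessThan] lessThan_iff if_True)
qed

lemma sum_hexad_pt:
  assumes "h \<in> hexad_sets"
  shows "(\<Sum>n<22. hexad_pt a h p n * v n) = a * (\<Sum>n\<in>h. sgn_of (n \<in> p) * v n)"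
proof -
  have "(\<Sum>n\<in>h. a * (sgn_of (n \<in> p) * v n)) = (\<Sum>n<22. hexad_pt a h p n * v n)"
    using hexad_setsD[OF assms] by (intro sum.mono_neutral_cong_left) (auto simp: hexad_pt_def)
  then show ?thesis
    by (simp add: sum_distrib_left)
qed

lemma sum_code_pt: "(\<Sum>n<22. code_pt a w n * v n) = a * (\<Sum>n<22. sgn_of (w ! n) * v n)"
  unfolding sum_distrib_left by (intro sum.cong) (auto simp: code_pt_def)

text \<open>Both points have all entries \<open>1 / 4\<close> up to sign, but their coordinate sums
  are 0 and -2.\<close>

lemma code_pt_quarter_ne:
  assumes "w \<in> code_words" "weight w = 11" "w' \<in> code_words" "weight w' = 7"
  shows "code_pt (1 / 4) w \<noteq> code_pt (- 1 / 4) w'"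
proof
  assume "code_pt (1 / 4) w = code_pt (- 1 / 4) w'"
  then have "(\<Sum>n<22. code_pt (1 / 4) w n * 1) = (\<Sum>n<22. code_pt (- 1 / 4) w' n * 1)"
    by simp
  then show False
    unfolding sum_code_pt using assms by (simp add: sum_sgn_of_word length_code_word)
qed

section \<open>Sums over the point set\<close>

lemma finite_inner_pts: "finite inner_pts"
  by (simp add: inner_pts_def)

lemma finite_hexad_pairs: "h \<in> hexad_sets \<Longrightarrow> finite {p. p \<subseteq> h \<and> card p = k}"
  by (rule finite_subset[of _ "Pow h"]) (auto dest: hexad_setsD)

lemma finite_outer_pts: "finite outer_pts"
  by (auto simp: outer_pts_def finite_hexad_pairs)

lemma sum_inner_pts:
  fixes F :: "(nat \<Rightarrow> real) \<Rightarrow> 'b::comm_monoid_add"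
  shows "(\<Sum>q\<in>inner_pts. F q) = (\<Sum>i<22. F (coord_pt (- 1 / 3) i))
    + (\<Sum>h\<in>hexad_sets. F (hexad_pt (- 1 / 6) h {}))
    + (\<Sum>w | w \<in> code_words \<and> weight w = 15. F (code_pt (1 / 12) w))"
proof -
  have inj: "inj_on (\<lambda>h. hexad_pt (- 1 / 6) h {}) hexad_sets"
    by (rule inj_onI) (auto dest: hexad_pt_eqD[rotated 3])
  have "(\<Sum>q\<in>inner_pts. F q) = (\<Sum>q\<in>coord_pt (- 1 / 3) ` {..<22}. F q)
      + (\<Sum>q\<in>(\<lambda>h. hexad_pt (- 1 / 6) h {}) ` hexad_sets. F q)
      + (\<Sum>q\<in>code_pt (1 / 12) ` {w \<in> code_words. weight w = 15}. F q)"
    unfolding inner_pts_def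
    by (subst sum.union_disjoint; (subst sum.union_disjoint)?)
      (auto simp: coord_ne_code_pt hexad_ne_code_pt coord_ne_hexad_pt
        coord_ne_code_pt[THEN not_sym] hexad_ne_code_pt[THEN not_sym] coord_ne_hexad_pt[THEN not_sym])
  then show ?thesis
    unfolding sum.reindex[OF inj] by (simp add: sum.reindex inj_coord_pt inj_code_pt)
qed

lemma sum_outer_pts:
  fixes F :: "(nat \<Rightarrow> real) \<Rightarrow> 'b::comm_monoid_add"
  shows "(\<Sum>q\<in>outer_pts. F q) = (\<Sum>i<22. F (coord_pt 1 i))
    + (\<Sum>h\<in>hexad_sets. \<Sum>p | p \<subseteq> h \<and> card p = 2. F (hexad_pt (- 1 / 2) h p))
    + ((\<Sum>w | w \<in> code_words \<and> weight w = 11. F (code_pt (1 / 4) w))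
      + (\<Sum>w | w \<in> code_words \<and> weight w = 7. F (code_pt (- 1 / 4) w)))"
proof -
  let ?S = "SIGMA h:hexad_sets. {p. p \<subseteq> h \<and> card p = 2}"
  have inj: "inj_on (\<lambda>(h, p). hexad_pt (- 1 / 2) h p) ?S"
  proof (rule inj_onI)
    fix x y assume "x \<in> ?S" "y \<in> ?S" "(\<lambda>(h, p). hexad_pt (- 1 / 2) h p) x = (\<lambda>(h, p). hexad_pt (- 1 / 2) h p) y"
    then show "x = y"
      using hexad_pt_eqD[of "- 1 / 2" "snd x" "fst x" "snd y" "fst y"] by (auto simp: prod_eq_iff)
  qed
  have fin: "finite ?S"
    by (auto simp: finite_hexad_pairs)
  have "(\<Sum>q\<in>outer_pts. F q) = (\<Sum>q\<in>coord_pt 1 ` {..<22}. F q)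
      + (\<Sum>q\<in>(\<lambda>(h, p). hexad_pt (- 1 / 2) h p) ` ?S. F q)
      + (\<Sum>q\<in>code_pt (1 / 4) ` {w \<in> code_words. weight w = 11} \<union> code_pt (- 1 / 4) ` {w \<in> code_words. weight w = 7}. F q)"
    unfolding outer_pts_def
    using fin by (subst sum.union_disjoint; (subst sum.union_disjoint)?)
      (auto simp: coord_ne_code_pt hexad_ne_code_pt coord_ne_hexad_pt
        coord_ne_code_pt[THEN not_sym] hexad_ne_code_pt[THEN not_sym] coord_ne_hexad_pt[THEN not_sym])
  also have "(\<Sum>q\<in>code_pt (1 / 4) ` {w \<in> code_words. weight w = 11} \<union> code_pt (- 1 / 4) ` {w \<in> code_words. weight w = 7}. F q) =
      (\<Sum>q\<in>code_pt (1 / 4) ` {w \<in> code_words. weight w = 11}. F q) + (\<Sum>q\<in>code_pt (- 1 / 4) ` {w \<in> code_words. weight w = 7}. F q)"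
    by (rule sum.union_disjoint) (use code_pt_quarter_ne in auto)
  also have "(\<Sum>q\<in>(\<lambda>(h, p). hexad_pt (- 1 / 2) h p) ` ?S. F q) =
      (\<Sum>h\<in>hexad_sets. \<Sum>p | p \<subseteq> h \<and> card p = 2. F (hexad_pt (- 1 / 2) h p))"
    by (subst sum.reindex[OF inj], subst sum.Sigma) (auto simp: finite_hexad_pairs case_prod_unfold)
  finally show ?thesis
    by (simp add: sum.reindex inj_coord_pt inj_code_pt)
qed

lemma card_inner_pts: "card inner_pts = 275"
  using sum_inner_pts[of "\<lambda>_. 1 :: nat"] card_hexad_sets card_code_weight by simp

lemma card_outer_pts: "card outer_pts = 2025"
proof -
  have "card {p. p \<subseteq> h \<and> card p = 2} = 15" if "h \<in> hexad_sets" for h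
    using n_subsets[of h 2] hexad_setsD[OF that] by (simp add: choose_two)
  then show ?thesis
    using sum_outer_pts[of "\<lambda>_. 1 :: nat"] card_hexad_sets card_code_weight by simp
qed

lemma pts_vanish: "q \<in> inner_pts \<union> outer_pts \<Longrightarrow> \<not> n < 22 \<Longrightarrow> q n = 0"
  by (auto simp: inner_pts_def outer_pts_def coord_pt_def hexad_pt_def code_pt_def dest!: hexad_setsD(1))

lemma sums_coord_pt:
  assumes "i < 22"
  shows "(\<Sum>n<22. coord_pt a i n) = a" "(\<Sum>n<22. coord_pt a i n ^ 2) = a ^ 2"
proof -
  show "(\<Sum>n<22. coord_pt a i n) = a"
    using sum_coord_pt[OF assms, of a "\<lambda>_. 1"] by simp
  show "(\<Sum>n<22. coord_pt a i n ^ 2) = a ^ 2"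
    using sum_coord_pt[OF assms, of a "coord_pt a i"] by (simp add: power2_eq_square coord_pt_def)
qed

lemma sums_hexad_pt:
  assumes h: "h \<in> hexad_sets" and p: "p \<subseteq> h"
  shows "(\<Sum>n<22. hexad_pt a h p n) = a * (6 - 2 * real (card p))" "(\<Sum>n<22. hexad_pt a h p n ^ 2) = 6 * a ^ 2"
proof -
  show "(\<Sum>n<22. hexad_pt a h p n) = a * (6 - 2 * real (card p))"
    using sum_hexad_pt[OF h, of a p "\<lambda>_. 1"] sum_sgn_of_subset[OF _ p] hexad_setsD[OF h] by simp
  have "(\<Sum>n\<in>h. sgn_of (n \<in> p) * hexad_pt a h p n) = (\<Sum>n\<in>h. a)"
    by (intro sum.cong) (auto simp: hexad_pt_def sgn_of_def)
  then show "(\<Sum>n<22. hexad_pt a h p n ^ 2) = 6 * a ^ 2"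
    using sum_hexad_pt[OF h, of a p "hexad_pt a h p"] hexad_setsD[OF h] by (simp add: power2_eq_square)
qed

lemma sums_code_pt:
  assumes w: "w \<in> code_words"
  shows "(\<Sum>n<22. code_pt a w n) = a * (22 - 2 * real (weight w))" "(\<Sum>n<22. code_pt a w n ^ 2) = 22 * a ^ 2"
proof -
  show "(\<Sum>n<22. code_pt a w n) = a * (22 - 2 * real (weight w))"
    using sum_code_pt[of a w "\<lambda>_. 1"] sum_sgn_of_word length_code_word[OF w] by simp
  have "(\<Sum>n<22. sgn_of (w ! n) * code_pt a w n) = (\<Sum>n<22::nat. a)"
    by (intro sum.cong) (auto simp: code_pt_def sgn_of_def)
  then show "(\<Sum>n<22. code_pt a w n ^ 2) = 22 * a ^ 2"
    using sum_code_pt[of a w "code_pt a w"] by (simp add: power2_eq_square)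
qed

text \<open>At height 1 and with coordinate sum \<open>s\<close>, \<open>d = (1 + s) / 2\<close>, so
  a scaled line has squared norm \<open>|q|^2 + (1 + s)^2 / 8\<close>. Subtracting 1/30, the squared
  distance of the hyperplane from the origin, leaves this form; its value is 24 / 144 - 1 / 30 here
  and 24 / 16 - 1 / 30 for the outer points.\<close>

lemma inner_pts_form:
  "q \<in> inner_pts \<Longrightarrow> (\<Sum>n<22. q n ^ 2) + (\<Sum>n<22. q n) ^ 2 / 8 + (\<Sum>n<22. q n) / 4 + 11 / 120 = 2 / 15"
  by (auto simp: inner_pts_def sums_coord_pt sums_hexad_pt sums_code_pt power_divide)

lemma outer_pts_form:
  "q \<in> outer_pts \<Longrightarrow> (\<Sum>n<22. q n ^ 2) + (\<Sum>n<22. q n) ^ 2 / 8 + (\<Sum>n<22. q n) / 4 + 11 / 120 = 22 / 15"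
  by (auto simp: outer_pts_def sums_coord_pt sums_hexad_pt sums_code_pt power_divide)

text \<open>The linear form \<open>(2 * t, v - t)\<close> takes on a line the value height times
  \<open>t + (\<Sum>n<22. q n * v n)\<close>. The sixth powers of the heights, 4096 * 729 and 4096,
  produce the weights, and 15/2 is 30720 / 4096.\<close>

lemma sum_pts_sextic:
  fixes v :: "nat \<Rightarrow> real"
  shows "729 * (\<Sum>q\<in>inner_pts. (t + (\<Sum>n<22. q n * v n)) ^ 6) + (\<Sum>q\<in>outer_pts. (t + (\<Sum>n<22. q n * v n)) ^ 6) =
    15 / 2 * ((\<Sum>n<22. v n ^ 2) - 2 * t * (\<Sum>n<22. v n) + 30 * t ^ 2) ^ 3"
proof -
  define u where "u n = v n - t" for n
  define G where "G q = (t + (\<Sum>n<22. q n * v n)) ^ 6" for q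
  have sg: "(\<Sum>n\<in>h. sgn_of (n \<in> p) * u n) = (\<Sum>n\<in>h. sgn_of (n \<in> p) * v n) - t * (6 - 2 * real (card p))"
    if "h \<in> hexad_sets" "p \<subseteq> h" for h p
  proof -
    have "(\<Sum>n\<in>h. sgn_of (n \<in> p) * u n) = (\<Sum>n\<in>h. sgn_of (n \<in> p) * v n) - t * (\<Sum>n\<in>h. sgn_of (n \<in> p))"
      by (simp add: u_def algebra_simps sum_subtractf sum_distrib_left)
    then show ?thesis
      using sum_sgn_of_subset[of h p] hexad_setsD[OF that(1)] that(2) by simp
  qed
  have sw: "(\<Sum>n<22. sgn_of (w ! n) * u n) = (\<Sum>n<22. sgn_of (w ! n) * v n) - t * (22 - 2 * real (weight w))"
    if "w \<in> code_words" for w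
  proof -
    have "(\<Sum>n<22. sgn_of (w ! n) * u n) = (\<Sum>n<22. sgn_of (w ! n) * v n) - t * (\<Sum>n<22. sgn_of (w ! n))"
      by (simp add: u_def algebra_simps sum_subtractf sum_distrib_left)
    then show ?thesis
      using sum_sgn_of_word[OF length_code_word[OF that]] by simp
  qed
  have A: "4096 * (729 * (\<Sum>i<22. G (coord_pt (- 1 / 3) i)) + (\<Sum>i<22. G (coord_pt 1 i))) =
      (\<Sum>i<22. (4 * (2 * t) + 4 * u i) ^ 6 + (4 * (2 * t) - 4 * u i) ^ 6)"
    unfolding sum_distrib_left sum.distrib[symmetric]
  proof (intro sum.cong refl)
    fix i :: nat assume "i \<in> {..<22}"
    then show "4096 * (729 * G (coord_pt (- 1 / 3) i) + G (coord_pt 1 i)) =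
        (4 * (2 * t) + 4 * u i) ^ 6 + (4 * (2 * t) - 4 * u i) ^ 6"
      unfolding G_def by (simp only: sum_coord_pt lessThan_iff u_def) algebra
  qed
  have B: "4096 * (729 * (\<Sum>h\<in>hexad_sets. G (hexad_pt (- 1 / 6) h {}))
        + (\<Sum>h\<in>hexad_sets. \<Sum>p | p \<subseteq> h \<and> card p = 2. G (hexad_pt (- 1 / 2) h p))) =
      64 * (\<Sum>h\<in>hexad_sets. \<Sum>p | p \<subseteq> h \<and> card p \<in> {0, 2}. (\<Sum>i\<in>h. sgn_of (i \<in> p) * u i) ^ 6)"
    unfolding sum_distrib_left[of _ _ hexad_sets] sum.distrib[symmetric]
  proof (intro sum.cong refl)
    fix h assume h: "h \<in> hexad_sets"
    have split: "{p. p \<subseteq> h \<and> card p \<in> {0, 2}} = insert {} {p. p \<subseteq> h \<and> card p = 2}"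
      using hexad_setsD[OF h] by (auto simp: finite_subset)
    have e: "4096 * (729 * G (hexad_pt (- 1 / 6) h {})) = 64 * (\<Sum>i\<in>h. sgn_of (i \<in> {}) * u i) ^ 6"
      unfolding G_def sum_hexad_pt[OF h] sg[OF h empty_subsetI] card.empty of_nat_0 by algebra
    have "4096 * G (hexad_pt (- 1 / 2) h p) = 64 * (\<Sum>i\<in>h. sgn_of (i \<in> p) * u i) ^ 6"
      if "p \<subseteq> h" "card p = 2" for p
      unfolding G_def sum_hexad_pt[OF h] sg[OF h that(1)] that(2) of_nat_numeral by algebra
    then have "4096 * (\<Sum>p | p \<subseteq> h \<and> card p = 2. G (hexad_pt (- 1 / 2) h p)) =
        64 * (\<Sum>p | p \<subseteq> h \<and> card p = 2. (\<Sum>i\<in>h. sgn_of (i \<in> p) * u i) ^ 6)"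
      unfolding sum_distrib_left by (intro sum.cong) auto
    then show "4096 * (729 * G (hexad_pt (- 1 / 6) h {}) + (\<Sum>p | p \<subseteq> h \<and> card p = 2. G (hexad_pt (- 1 / 2) h p))) =
        64 * (\<Sum>p | p \<subseteq> h \<and> card p \<in> {0, 2}. (\<Sum>i\<in>h. sgn_of (i \<in> p) * u i) ^ 6)"
      unfolding split using e finite_hexad_pairs[OF h] by (subst sum.insert) (simp_all only: distrib_left, auto)
  qed
  have C: "4096 * (729 * (\<Sum>w | w \<in> code_words \<and> weight w = 15. G (code_pt (1 / 12) w))
        + ((\<Sum>w | w \<in> code_words \<and> weight w = 11. G (code_pt (1 / 4) w))
          + (\<Sum>w | w \<in> code_words \<and> weight w = 7. G (code_pt (- 1 / 4) w)))) =
      (\<Sum>w\<in>code_words. (2 * (2 * t) + (\<Sum>n<22. sgn_of (w ! n) * u n)) ^ 6)"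
  proof -
    have 1: "4096 * (729 * (\<Sum>w | w \<in> code_words \<and> weight w = 15. G (code_pt (1 / 12) w))) =
        (\<Sum>w | w \<in> code_words \<and> weight w = 15. (2 * (2 * t) + (\<Sum>n<22. sgn_of (w ! n) * u n)) ^ 6)"
      unfolding sum_distrib_left[of _ _ "{w. _ w}"]
    proof (intro sum.cong refl)
      fix w assume "w \<in> {w. w \<in> code_words \<and> weight w = 15}"
      then have w: "w \<in> code_words" "weight w = 15"
        by auto
      show "4096 * (729 * G (code_pt (1 / 12) w)) = (2 * (2 * t) + (\<Sum>n<22. sgn_of (w ! n) * u n)) ^ 6"
        unfolding G_def sum_code_pt sw[OF w(1)] w(2) of_nat_numeral by algebra
    qed
    have 2: "4096 * (\<Sum>w | w \<in> code_words \<and> weight w = 11. G (code_pt (1 / 4) w)) =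
        (\<Sum>w | w \<in> code_words \<and> weight w = 11. (2 * (2 * t) + (\<Sum>n<22. sgn_of (w ! n) * u n)) ^ 6)"
      unfolding sum_distrib_left[of _ _ "{w. _ w}"]
    proof (intro sum.cong refl)
      fix w assume "w \<in> {w. w \<in> code_words \<and> weight w = 11}"
      then have w: "w \<in> code_words" "weight w = 11"
        by auto
      show "4096 * G (code_pt (1 / 4) w) = (2 * (2 * t) + (\<Sum>n<22. sgn_of (w ! n) * u n)) ^ 6"
        unfolding G_def sum_code_pt sw[OF w(1)] w(2) of_nat_numeral by algebra
    qed
    have 3: "4096 * (\<Sum>w | w \<in> code_words \<and> weight w = 7. G (code_pt (- 1 / 4) w)) =
        (\<Sum>w | w \<in> code_words \<and> weight w = 7. (2 * (2 * t) + (\<Sum>n<22. sgn_of (w ! n) * u n)) ^ 6)"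
      unfolding sum_distrib_left[of _ _ "{w. _ w}"]
    proof (intro sum.cong refl)
      fix w assume "w \<in> {w. w \<in> code_words \<and> weight w = 7}"
      then have w: "w \<in> code_words" "weight w = 7"
        by auto
      show "4096 * G (code_pt (- 1 / 4) w) = (2 * (2 * t) + (\<Sum>n<22. sgn_of (w ! n) * u n)) ^ 6"
        unfolding G_def sum_code_pt sw[OF w(1)] w(2) of_nat_numeral by algebra
    qed
    show ?thesis
      unfolding sum_code_by_weight distrib_left 1 2 3 by (simp only: ac_simps)
  qed
  have "4096 * (729 * (\<Sum>q\<in>inner_pts. G q) + (\<Sum>q\<in>outer_pts. G q)) =
      30720 * (2 * (2 * t) ^ 2 + (\<Sum>i<22. u i ^ 2)) ^ 3"
    unfolding sum_lines_sextic[symmetric] A[symmetric] B[symmetric] C[symmetric] sum_inner_pts sum_outer_pts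
    by (simp only: distrib_left ac_simps)
  moreover have "(\<Sum>i<22. u i ^ 2) = (\<Sum>n<22. v n ^ 2) - 2 * t * (\<Sum>n<22. v n) + 22 * t ^ 2"
    by (simp add: u_def power2_diff sum.distrib sum_subtractf sum_distrib_left mult_ac)
  then have "2 * (2 * t) ^ 2 + (\<Sum>i<22. u i ^ 2) = (\<Sum>n<22. v n ^ 2) - 2 * t * (\<Sum>n<22. v n) + 30 * t ^ 2"
    by (simp add: power_mult_distrib)
  ultimately show ?thesis
    unfolding G_def by (simp only:) simp
qed

lemma power_sums_of_sextic:
  fixes X :: "(real^'n) set"
  assumes sextic: "\<And>\<xi> t. (\<Sum>x\<in>X. w x * (t + x \<bullet> \<xi>) ^ 6) = a * (norm \<xi> ^ 2 + b * t ^ 2) ^ 3"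
    and k: "k \<le> 6"
  shows "\<exists>c. \<forall>\<xi>. (\<Sum>x\<in>X. w x * (x \<bullet> \<xi>) ^ k) = c * norm \<xi> ^ k"
proof -
  \<comment> \<open>Coefficients in \<open>t\<close> of the right-hand side, up to the power of
    \<open>norm \<xi>\<close>; for odd \<open>i\<close> they vanish, and so do the odd power
    sums.\<close>
  define \<gamma> where "\<gamma> i = (if even i then a * of_nat (3 choose (i div 2)) * b ^ (i div 2) else 0)" for i
  have coeff: "of_nat (6 choose i) * (\<Sum>x\<in>X. w x * (x \<bullet> \<xi>) ^ (6 - i)) = \<gamma> i * norm \<xi> ^ (6 - i)"
    if "i \<le> 6" for i \<xi>
  proof -
    have "(\<Sum>i\<le>6. (of_nat (6 choose i) * (\<Sum>x\<in>X. w x * (x \<bullet> \<xi>) ^ (6 - i))) * t ^ i) =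
        (\<Sum>i\<le>6. (\<gamma> i * norm \<xi> ^ (6 - i)) * t ^ i)" for t
    proof -
      have "(\<Sum>i\<le>6. (of_nat (6 choose i) * (\<Sum>x\<in>X. w x * (x \<bullet> \<xi>) ^ (6 - i))) * t ^ i) =
          (\<Sum>i\<le>6. \<Sum>x\<in>X. w x * (of_nat (6 choose i) * t ^ i * (x \<bullet> \<xi>) ^ (6 - i)))"
        unfolding sum_distrib_left sum_distrib_right by (intro sum.cong refl) (simp only: mult_ac)
      also have "\<dots> = (\<Sum>x\<in>X. w x * (t + x \<bullet> \<xi>) ^ 6)"
        unfolding binomial_ring sum_distrib_left by (rule sum.swap)
      also have "\<dots> = a * (norm \<xi> ^ 2 + b * t ^ 2) ^ 3"
        by (rule sextic)
      also have "\<dots> = (\<Sum>i\<le>6. (\<gamma> i * norm \<xi> ^ (6 - i)) * t ^ i)"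
      proof -
        have "{..6::nat} = {0, 1, 2, 3, 4, 5, 6}"
          by auto
        moreover have "(3 choose 2) = (3 :: nat)"
          by (simp add: choose_two)
        ultimately have "(\<Sum>i\<le>6. (\<gamma> i * norm \<xi> ^ (6 - i)) * t ^ i) =
            a * norm \<xi> ^ 6 + a * 3 * b * norm \<xi> ^ 4 * t ^ 2 + a * 3 * b ^ 2 * norm \<xi> ^ 2 * t ^ 4 + a * b ^ 3 * t ^ 6"
          by (simp add: \<gamma>_def)
        then show ?thesis
          by algebra
      qed
      finally show ?thesis .
    qed
    then show ?thesis
      using that polyfun_eq_coeffs[of "\<lambda>i. of_nat (6 choose i) * (\<Sum>x\<in>X. w x * (x \<bullet> \<xi>) ^ (6 - i))" 6
          "\<lambda>i. \<gamma> i * norm \<xi> ^ (6 - i)"] by blast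
  qed
  have "(\<Sum>x\<in>X. w x * (x \<bullet> \<xi>) ^ k) = \<gamma> (6 - k) / of_nat (6 choose (6 - k)) * norm \<xi> ^ k" for \<xi>
  proof -
    have "real (6 choose (6 - k)) \<noteq> 0"
      by simp
    then show ?thesis
      using coeff[of "6 - k" \<xi>] k by (simp add: field_simps)
  qed
  then show ?thesis
    by blast
qed

section \<open>Orthonormal coordinates and assembly of the design\<close>

theorem theorem1:
  shows "\<exists>(X :: (real^22) set) (w :: real^22 \<Rightarrow> real) r1 r2 w1 w2.
     euclidean_tight_design X w 3 \<and>
     0 < r1 \<and> r1 < r2 \<and> norm ` X = {r1, r2} \<and>
     card X = (22 + 3) choose 3 \<and> card X = 2300 \<and>
     r2 / r1 = sqrt 11 \<and>
     (\<forall>x\<in>layer X r1. w x = w1) \<and> (\<forall>x\<in>layer X r2. w x = w2) \<and>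
     w2 / w1 = 1 / 729 \<and>
     card (layer X r1) = 275 \<and> card (layer X r2) = 2025"
proof -
  obtain e :: "22 \<Rightarrow> nat" where e: "bij_betw e UNIV {..<22}"
    using ex_bij_betw_finite_nat[of "UNIV :: 22 set"] by (auto simp: atLeast0LessThan)
  define r1 r2 where "r1 = sqrt (2 / 15)" and "r2 = sqrt (22 / 15)"
  \<comment> \<open>\<open>\<kappa>\<close> and \<open>\<mu>\<close> make \<open>pt\<close> the projection along \<open>(4, -1, \<dots>, -1)\<close> in an orthonormal basis.\<close>
  define \<kappa> \<mu> where "\<kappa> = (sqrt 15 - 2) / 44" and "\<mu> = sqrt 15 / 60"
  \<comment> \<open>The first three match the coefficients of the quadratic form in
    \<open>inner_pts_form\<close>; \<kappa> is the positive root of the first. The fourth cancels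
    cross terms in \<open>sextic\<close>, and the last gives injectivity.\<close>
  have const_eqs: "22 * \<kappa> ^ 2 + 2 * \<kappa> = 1 / 8" "2 * \<mu> * (1 + 22 * \<kappa>) = 1 / 4" "\<mu> ^ 2 = 1 / 240"
    "1 + 22 * \<kappa> = 30 * \<mu>" "1 + 22 * \<kappa> \<noteq> 0"
    by (auto simp: \<kappa>_def \<mu>_def field_simps power2_eq_square)
  define pt :: "(nat \<Rightarrow> real) \<Rightarrow> real^22"
    where "pt q = (\<chi> i. q (e i) + (\<kappa> * (\<Sum>n<22. q n) + \<mu>))" for q
  define X1 X2 where "X1 = pt ` inner_pts" and "X2 = pt ` outer_pts"
  define w where "w x = (if norm x = r1 then 729 else (1::real))" for x :: "real^22"
  have reindex: "(\<Sum>i\<in>UNIV. f (e i)) = (\<Sum>n<22. f n)" for f :: "nat \<Rightarrow> real"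
    by (rule sum.reindex_bij_betw[OF e])
  have norm_pt: "norm (pt q) ^ 2 = (\<Sum>n<22. q n ^ 2) + (\<Sum>n<22. q n) ^ 2 / 8 + (\<Sum>n<22. q n) / 4 + 11 / 120" for q
  proof -
    define s where "s = (\<Sum>n<22. q n)"
    have "norm (pt q) ^ 2 = (\<Sum>i\<in>UNIV. (q (e i) + (\<kappa> * s + \<mu>)) ^ 2)"
      unfolding power2_norm_eq_inner by (simp add: inner_vec_def pt_def s_def power2_eq_square)
    also have "\<dots> = (\<Sum>n<22. (q n + (\<kappa> * s + \<mu>)) ^ 2)"
      by (rule reindex)
    also have "\<dots> = (\<Sum>n<22. q n ^ 2) + 2 * (\<kappa> * s + \<mu>) * s + 22 * (\<kappa> * s + \<mu>) ^ 2"
      by (simp add: power2_sum sum.distrib sum_distrib_left sum_distrib_right s_def mult_ac)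
    also have "\<dots> = (\<Sum>n<22. q n ^ 2) + (22 * \<kappa> ^ 2 + 2 * \<kappa>) * s ^ 2 + 2 * \<mu> * (1 + 22 * \<kappa>) * s + 22 * \<mu> ^ 2"
      by algebra
    finally show ?thesis
      unfolding const_eqs(1-3) by (simp add: s_def)
  qed
  have norm1: "norm x = r1" if "x \<in> X1" for x
    using that norm_pt inner_pts_form unfolding X1_def r1_def by (auto intro!: real_sqrt_unique[symmetric])
  have norm2: "norm x = r2" if "x \<in> X2" for x
    using that norm_pt outer_pts_form unfolding X2_def r2_def by (auto intro!: real_sqrt_unique[symmetric])
  have r: "0 < r1" "r1 < r2"
    by (simp_all add: r1_def r2_def)
  have inj: "inj_on pt (inner_pts \<union> outer_pts)"
  proof (rule inj_onI, rule ext)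
    fix q q' n assume q: "q \<in> inner_pts \<union> outer_pts" "q' \<in> inner_pts \<union> outer_pts" "pt q = pt q'"
    define s s' where "s = (\<Sum>n<22. q n)" and "s' = (\<Sum>n<22. q' n)"
    have eq: "q n + (\<kappa> * s + \<mu>) = q' n + (\<kappa> * s' + \<mu>)" if "n < 22" for n
    proof -
      have "n \<in> range e"
        using e that by (simp add: bij_betw_def)
      then obtain i where "n = e i"
        by blast
      then show ?thesis
        using arg_cong[OF q(3), of "\<lambda>x. x $ i"] by (simp add: pt_def s_def s'_def)
    qed
    have "(\<Sum>n<22. q n + (\<kappa> * s + \<mu>)) = (\<Sum>n<22. q' n + (\<kappa> * s' + \<mu>))"
      using eq by (intro sum.cong) auto
    then have "(1 + 22 * \<kappa>) * s = (1 + 22 * \<kappa>) * s'"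
      by (simp add: sum.distrib s_def[symmetric] s'_def[symmetric] algebra_simps)
    then have "s = s'"
      using const_eqs(5) by simp
    then show "q n = q' n"
      using eq[of n] pts_vanish[OF q(1)] pts_vanish[OF q(2)] by (cases "n < 22") auto
  qed
  have card1: "card X1 = 275"
    unfolding X1_def using inj card_inner_pts by (simp add: card_image inj_on_subset)
  have card2: "card X2 = 2025"
    unfolding X2_def using inj card_outer_pts by (simp add: card_image inj_on_subset)
  have fin: "finite X1" "finite X2"
    by (simp_all add: X1_def X2_def finite_inner_pts finite_outer_pts)
  have disj: "X1 \<inter> X2 = {}"
    using norm1 norm2 r by force
  \<comment> \<open>The affine map \<open>pt\<close> is moved to the other side: its linear part
    turns \<xi> into \<open>v\<close>, its constant part turns \<tau> into \<open>t\<close>.\<close>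
  have sextic: "(\<Sum>x\<in>X1 \<union> X2. w x * (\<tau> + x \<bullet> \<xi>) ^ 6) = 15 / 2 * (norm \<xi> ^ 2 + 30 * \<tau> ^ 2) ^ 3" for \<xi> \<tau>
  proof -
    define x where "x n = \<xi> $ inv e n" for n
    have x: "\<xi> $ i = x (e i)" for i
      using e by (simp add: x_def bij_betw_def inv_f_f)
    define y where "y = (\<Sum>n<22. x n)"
    define v where "v n = x n + \<kappa> * y" for n
    have inner: "pt q \<bullet> \<xi> = (\<Sum>n<22. q n * v n) + \<mu> * y" for q
    proof -
      have "pt q \<bullet> \<xi> = (\<Sum>i\<in>UNIV. (q (e i) + (\<kappa> * (\<Sum>n<22. q n) + \<mu>)) * x (e i))"
        by (simp add: inner_vec_def pt_def x)
      also have "\<dots> = (\<Sum>n<22. (q n + (\<kappa> * (\<Sum>n<22. q n) + \<mu>)) * x n)"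
        by (rule reindex)
      also have "\<dots> = (\<Sum>n<22. q n * x n) + (\<kappa> * (\<Sum>n<22. q n) + \<mu>) * y"
        by (simp only: distrib_right sum.distrib sum_distrib_left y_def)
      also have "\<dots> = (\<Sum>n<22. q n * x n) + (\<Sum>n<22. q n) * (\<kappa> * y) + \<mu> * y"
        by algebra
      finally show ?thesis
        by (simp only: v_def distrib_left sum.distrib sum_distrib_right)
    qed
    have norm_\<xi>: "norm \<xi> ^ 2 = (\<Sum>n<22. x n ^ 2)"
      using reindex[of "\<lambda>n. x n ^ 2"] unfolding power2_norm_eq_inner by (simp add: inner_vec_def x power2_eq_square)
    have sum_v: "(\<Sum>n<22. v n) = (1 + 22 * \<kappa>) * y"
      by (simp add: v_def sum.distrib y_def[symmetric] algebra_simps)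
    have sum_v2: "(\<Sum>n<22. v n ^ 2) = norm \<xi> ^ 2 + (22 * \<kappa> ^ 2 + 2 * \<kappa>) * y ^ 2"
    proof -
      have "(\<Sum>n<22. v n ^ 2) = (\<Sum>n<22. x n ^ 2) + 2 * (\<kappa> * y) * y + 22 * (\<kappa> * y) ^ 2"
        by (simp add: v_def power2_sum sum.distrib sum_distrib_left sum_distrib_right y_def mult_ac)
      then show ?thesis
        unfolding norm_\<xi> by algebra
    qed
    define t where "t = \<tau> + \<mu> * y"
    have "(\<Sum>x\<in>X1 \<union> X2. w x * (\<tau> + x \<bullet> \<xi>) ^ 6) =
        (\<Sum>x\<in>X1. w x * (\<tau> + x \<bullet> \<xi>) ^ 6) + (\<Sum>x\<in>X2. w x * (\<tau> + x \<bullet> \<xi>) ^ 6)"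
      by (rule sum.union_disjoint[OF fin disj])
    also have "(\<Sum>x\<in>X1. w x * (\<tau> + x \<bullet> \<xi>) ^ 6) = 729 * (\<Sum>x\<in>X1. (\<tau> + x \<bullet> \<xi>) ^ 6)"
      unfolding sum_distrib_left using norm1 by (intro sum.cong) (auto simp: w_def)
    also have "(\<Sum>x\<in>X1. (\<tau> + x \<bullet> \<xi>) ^ 6) = (\<Sum>q\<in>inner_pts. (t + (\<Sum>n<22. q n * v n)) ^ 6)"
      unfolding X1_def using inj
      by (subst sum.reindex) (auto simp: inj_on_subset inner t_def algebra_simps)
    also have "(\<Sum>x\<in>X2. w x * (\<tau> + x \<bullet> \<xi>) ^ 6) = (\<Sum>x\<in>X2. (\<tau> + x \<bullet> \<xi>) ^ 6)"
      using norm2 r by (intro sum.cong) (auto simp: w_def)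
    also have "(\<Sum>x\<in>X2. (\<tau> + x \<bullet> \<xi>) ^ 6) = (\<Sum>q\<in>outer_pts. (t + (\<Sum>n<22. q n * v n)) ^ 6)"
      unfolding X2_def using inj
      by (subst sum.reindex) (auto simp: inj_on_subset inner t_def algebra_simps)
    also have "729 * (\<Sum>q\<in>inner_pts. (t + (\<Sum>n<22. q n * v n)) ^ 6) + (\<Sum>q\<in>outer_pts. (t + (\<Sum>n<22. q n * v n)) ^ 6) =
        15 / 2 * ((\<Sum>n<22. v n ^ 2) - 2 * t * (\<Sum>n<22. v n) + 30 * t ^ 2) ^ 3"
      by (rule sum_pts_sextic)
    \<comment> \<open>Completing the square: the mixed terms in \<tau> and \<open>y\<close> cancel,
      and the terms in \<open>y ^ 2\<close> cancel since
      \<open>30 * \<mu> ^ 2 = 1 / 8\<close>.\<close>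
    also have "(\<Sum>n<22. v n ^ 2) - 2 * t * (\<Sum>n<22. v n) + 30 * t ^ 2 = norm \<xi> ^ 2 + 30 * \<tau> ^ 2"
    proof -
      have "(\<Sum>n<22. v n ^ 2) - 2 * t * (\<Sum>n<22. v n) + 30 * t ^ 2 =
          norm \<xi> ^ 2 + 1 / 8 * y ^ 2 - 2 * (\<tau> + \<mu> * y) * (30 * \<mu> * y) + 30 * (\<tau> + \<mu> * y) ^ 2"
        unfolding sum_v sum_v2 t_def const_eqs(1) const_eqs(4) ..
      also have "\<dots> = norm \<xi> ^ 2 + 30 * \<tau> ^ 2 + (1 / 8 - 30 * \<mu> ^ 2) * y ^ 2"
        by algebra
      finally show ?thesis
        by (simp add: const_eqs(3))
    qed
    finally show ?thesis .
  qed
  have norms: "norm ` (X1 \<union> X2) = {r1, r2}"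
  proof -
    have "X1 \<noteq> {}" "X2 \<noteq> {}"
      using card1 card2 by auto
    then show ?thesis
      using norm1 norm2 by (force simp: image_Un)
  qed
  have layers: "layer (X1 \<union> X2) r1 = X1" "layer (X1 \<union> X2) r2 = X2"
    using norm1 norm2 r by (force simp: layer_def)+
  have card: "card (X1 \<union> X2) = 2300"
    using card_Un_disjoint[OF fin disj] card1 card2 by simp
  have choose: "(25 choose 3) = (2300 :: nat)"
    by (simp add: binomial_fact' fact_numeral)
  have design: "euclidean_design (X1 \<union> X2) w 6"
    using fin by (intro euclidean_design_of_power_sums power_sums_of_sextic[OF sextic]) (auto simp: w_def)
  have "euclidean_tight_design (X1 \<union> X2) w 3"
    unfolding euclidean_tight_design_def
    using design card choose dim_PeS_two_spheres[OF r, of "support_spheres (X1 \<union> X2)"]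
    by (simp add: support_spheres_def norms)
  moreover have "r2 / r1 = sqrt 11"
    by (simp add: r1_def r2_def real_sqrt_divide[symmetric])
  moreover have "\<forall>x\<in>layer (X1 \<union> X2) r1. w x = 729" "\<forall>x\<in>layer (X1 \<union> X2) r2. w x = 1"
    using norm1 norm2 r unfolding layers by (auto simp: w_def)
  ultimately show ?thesis
    using r norms card choose card1 card2 layers
    by (intro exI[of _ "X1 \<union> X2"] exI[of _ w] exI[of _ r1] exI[of _ r2] exI[of _ 729] exI[of _ 1]) simp
qed

end
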